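(* Let $p,q$ be distinct primes and let $m,n$ be positive integers. Then (1) $K_1(C_{p^m}\oplus C_p^n) \le K_1(C_{p^m}) + K_1(C_p^{n+1})-1$; (2) $K_1(C_{p^m}\oplus C_q^n) \le K_1(C_{p^m}) + K_1(C_q^n)$.
   Context: Groups are finite abelian, written additively; $C_n$ is the cyclic group of order $n$. An indexed multiset $S=\{g_1,\ldots,g_\ell\}$ over a set $X\subseteq G$ is a finite (possibly empty) indexed family of elements of $X$; for $I\subseteq[\ell]$ put $S(I)=\{g_i : i\in I\}$, and submultisets of $S$ are the $S(I)$. Put $\sigma(S)=\sum_{g\in S}g$ (with multiplicity), $\sigma(\emptyset)=0$. $S$ is zero-sum if $\sigma(S)=0$; minimal zero-sum if $\sigma(S)=0$ and $\sigma(S')\ne0$ for every $\emptyset\subsetneq S'\subsetneq S$. An irreducible factorization of $S$ over $G\setminus\{0\}$ is a partition $[\ell]=\bigsqcup_{i=1}^m I_i$ into nonempty sets with each $S(I_i)$ minimal zero-sum; two factorizations are equivalent iff they are the same set of blocks $\{I_1,\ldots,I_m\}$. A unique factorization indexed multiset (UFIM) over $G\setminus\{0\}$ is a zero-sum indexed multiset over $G\setminus\{0\}$ with exactly one irreducible factorization up to equivalence. The cross number of $S$ is $k(S)=\sum_{g\in S}\frac1{\mathrm{ord}(g)}$ (with multiplicity; $k(\emptyset)=0$), and $K_1(G)=\max\{k(S): S\text{ is a UFIM over }G\setminus\{0\}\}$. *)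

theory Defs
  imports "HOL-Algebra.Product_Groups" "HOL-Algebra.Multiplicative_Group" "HOL-Library.Disjoint_Sets"
    "HOL-Computational_Algebra.Primes"
begin

(* Abelian groups are multiplicative structures here: finprod G g I is the sum of the
   submultiset with index set I, and the neutral element of G plays the role of 0.
   An indexed multiset is a function g considered on a finite index set I only. *)

definition zero_sum :: "('a, 'b) monoid_scheme \<Rightarrow> ('i \<Rightarrow> 'a) \<Rightarrow> 'i set \<Rightarrow> bool" where
  "zero_sum G g I \<longleftrightarrow> finprod G g I = \<one>\<^bsub>G\<^esub>"

definition minimal_zero_sum :: "('a, 'b) monoid_scheme \<Rightarrow> ('i \<Rightarrow> 'a) \<Rightarrow> 'i set \<Rightarrow> bool" where
  "minimal_zero_sum G g I \<longleftrightarrow>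
     zero_sum G g I \<and> (\<forall>J. J \<noteq> {} \<and> J \<subset> I \<longrightarrow> \<not> zero_sum G g J)"

definition irreducible_factorization ::
  "('a, 'b) monoid_scheme \<Rightarrow> ('i \<Rightarrow> 'a) \<Rightarrow> 'i set \<Rightarrow> 'i set set \<Rightarrow> bool" where
  "irreducible_factorization G g I P \<longleftrightarrow>
     partition_on I P \<and> (\<forall>B\<in>P. minimal_zero_sum G g B)"

definition ufim :: "('a, 'b) monoid_scheme \<Rightarrow> ('i \<Rightarrow> 'a) \<Rightarrow> 'i set \<Rightarrow> bool" where
  "ufim G g I \<longleftrightarrow>
     finite I \<and> g \<in> I \<rightarrow> carrier G - {\<one>\<^bsub>G\<^esub>} \<and> zero_sum G g I \<and>
     (\<exists>!P. irreducible_factorization G g I P)"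

definition cross_number :: "('a, 'b) monoid_scheme \<Rightarrow> ('i \<Rightarrow> 'a) \<Rightarrow> 'i set \<Rightarrow> real" where
  "cross_number G g I = (\<Sum>i\<in>I. 1 / real (group.ord G (g i)))"

definition K1 :: "('a, 'b) monoid_scheme \<Rightarrow> real" where
  "K1 G = Max {cross_number G g {1..l} | (g :: nat \<Rightarrow> 'a) (l :: nat). ufim G g {1..l}}"

lemma irreducible_factorization_image:
  assumes "comm_group G" and g: "g \<in> I \<rightarrow> carrier G" and t: "inj_on t I" "t ` I = I"
    and gt: "\<And>i. i \<in> I \<Longrightarrow> g (t i) = g i" and P: "irreducible_factorization G g I P"
  shows "irreducible_factorization G g I ((`) t ` P)"
proof -
  interpret comm_group G by fact
  have part: "partition_on I P" and mz: "\<And>B. B \<in> P \<Longrightarrow> minimal_zero_sum G g B"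
    using P by (auto simp: irreducible_factorization_def)
  have sub: "B \<subseteq> I" if "B \<in> P" for B
    using part that by (auto simp: partition_on_def)
  have zs: "zero_sum G g (t ` B) \<longleftrightarrow> zero_sum G g B" if B: "B \<subseteq> I" for B
  proof -
    have inj: "inj_on t B" using t B by (meson inj_on_subset)
    have "finprod G g (t ` B) = finprod G (\<lambda>x. g (t x)) B"
      using B g t(2) by (intro finprod_reindex inj) blast
    also have "\<dots> = finprod G g B"
      using B g gt by (intro finprod_cong') auto
    finally show ?thesis by (simp add: zero_sum_def)
  qed
  have "partition_on (t ` I) ((`) t ` P - {{}})"
    using partition_on_inj_image[OF part t(1)] .
  moreover have "(`) t ` P - {{}} = (`) t ` P"
    using part by (auto simp: partition_on_def)
  ultimately have "partition_on I ((`) t ` P)"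
    using t(2) by simp
  moreover have "minimal_zero_sum G g (t ` B)" if B: "B \<in> P" for B
    unfolding minimal_zero_sum_def
  proof (intro conjI allI impI)
    show "zero_sum G g (t ` B)"
      using zs[OF sub[OF B]] mz[OF B] by (simp add: minimal_zero_sum_def)
  next
    fix J assume J: "J \<noteq> {} \<and> J \<subset> t ` B"
    then obtain J' where J': "J' \<subseteq> B" "J = t ` J'"
      by (meson psubset_imp_subset subset_imageE)
    with J have "J' \<noteq> {}" "J' \<subset> B" by auto
    with mz[OF B] have "\<not> zero_sum G g J'" by (auto simp: minimal_zero_sum_def)
    with J' zs[of J'] sub[OF B] show "\<not> zero_sum G g J" by auto
  qed
  ultimately show ?thesis by (auto simp: irreducible_factorization_def)
qed

lemma ufim_card_fibre_le_ord:
  assumes "comm_group G" and fin: "finite (carrier G)" and u: "ufim G g I"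
    and a: "a \<in> carrier G"
  shows "card {i \<in> I. g i = a} \<le> group.ord G a"
proof (cases "{i \<in> I. g i = a} = {}")
  case True
  then show ?thesis by (simp only: card.empty le0)
next
  case False
  interpret comm_group G by fact
  let ?A = "{i \<in> I. g i = a}"
  have finI: "finite I" and gI: "\<And>i. i \<in> I \<Longrightarrow> g i \<in> carrier G" "\<And>i. i \<in> I \<Longrightarrow> g i \<noteq> \<one>\<^bsub>G\<^esub>"
    using u by (auto simp: ufim_def)
  obtain P where P: "irreducible_factorization G g I P"
    and uniq: "\<And>Q. irreducible_factorization G g I Q \<Longrightarrow> Q = P"
    using u unfolding ufim_def by (elim conjE ex1E) metis
  have part: "partition_on I P" and mz: "\<And>B. B \<in> P \<Longrightarrow> minimal_zero_sum G g B"
    using P by (auto simp: irreducible_factorization_def)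
  obtain i where i: "i \<in> I" "g i = a" using False by auto
  obtain B where B: "B \<in> P" "i \<in> B" using part i by (auto simp: partition_on_def)
  have BI: "B \<subseteq> I" using part B by (auto simp: partition_on_def)
  have AB: "?A \<subseteq> B"
  proof
    fix j assume j: "j \<in> ?A"
    show "j \<in> B"
    proof (rule ccontr)
      assume jB: "j \<notin> B"
      let ?t = "\<lambda>x. if x = i then j else if x = j then i else x"
      have "irreducible_factorization G g I ((`) ?t ` P)"
      proof (rule irreducible_factorization_image[OF assms(1) _ _ _ _ P])
        show "g \<in> I \<rightarrow> carrier G" using gI by blast
        show "inj_on ?t I" by (auto simp: inj_on_def)
        show "?t ` I = I"
        proof
          show "?t ` I \<subseteq> I" using i j by auto
          show "I \<subseteq> ?t ` I"
          proof
            fix x assume "x \<in> I"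
            then have "?t x \<in> I" "x = ?t (?t x)" using i j by auto
            then show "x \<in> ?t ` I" by (rule rev_image_eqI)
          qed
        qed
        show "g (?t x) = g x" for x using i j by auto
      qed
      then have "(`) ?t ` P = P" by (rule uniq)
      then have tB: "?t ` B \<in> P" using B by blast
      have "B \<noteq> {i}"
      proof
        assume "B = {i}"
        then have "zero_sum G g {i}" using mz[OF B(1)] by (simp add: minimal_zero_sum_def)
        then show False using gI[OF i(1)] by (simp add: zero_sum_def Pi_def)
      qed
      then obtain k where k: "k \<in> B" "k \<noteq> i" using B by blast
      then have "k \<noteq> j" using jB by auto
      then have "k \<in> ?t ` B" using k by (intro rev_image_eqI[of k]) auto
      then have "\<not> disjnt (?t ` B) B" using k(1) unfolding disjnt_iff by metis
      then have "?t ` B = B"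
        using pairwiseD[OF partition_onD2[OF part] tB B(1)] by argo
      moreover have "j \<in> ?t ` B" using B by (intro rev_image_eqI[of i]) auto
      ultimately show False using jB by blast
    qed
  qed
  show ?thesis
  proof (rule ccontr)
    assume "\<not> ?thesis"
    then have less: "ord a < card ?A" by (simp only: not_le)
    then obtain J where J: "J \<subseteq> ?A" "card J = ord a"
      by (meson less_imp_le obtain_subset_with_card_n)
    have "ord a \<ge> 1" using ord_ge_1[OF fin a] .
    then have "J \<noteq> {}" using J by auto
    moreover have "J \<subset> B"
    proof -
      have "J \<noteq> ?A"
      proof
        assume "J = ?A"
        then have "card J = card ?A" by (rule arg_cong)
        then show False using J(2) less by linarith
      qed
      then have "J \<subset> ?A" using J(1) by (rule psubsetI[rotated])
      then show ?thesis using AB by (rule psubset_subset_trans)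
    qed
    moreover have "finprod G g J = \<one>\<^bsub>G\<^esub>"
    proof -
      have "finprod G g J = finprod G (\<lambda>_. a) J"
      proof (rule finprod_cong')
        show "g x = a" if "x \<in> J" for x using that J(1) by blast
      qed (use a in auto)
      then show ?thesis unfolding finprod_const[OF a] J(2) using a by simp
    qed
    ultimately show False
      using mz[OF B(1)] unfolding minimal_zero_sum_def zero_sum_def by blast
  qed
qed

(* The maximum in K1 is a maximum over a finite nonempty set whenever G is finite. *)
lemma K1_well_defined:
  fixes G :: "('a, 'b) monoid_scheme"
  assumes "comm_group G" and fin: "finite (carrier G)"
  defines "K \<equiv> {cross_number G g {1..l} | (g :: nat \<Rightarrow> 'a) (l :: nat). ufim G g {1..l}}"
  shows "finite K" and "K \<noteq> {}"
proof -
  interpret comm_group G by fact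
  define N where "N = (\<Sum>a\<in>carrier G. ord a)"
  define F where "F = (\<Union>l\<in>{..N}. (\<lambda>g. cross_number G g {1..l}) ` ({1..l} \<rightarrow>\<^sub>E carrier G))"
  have "K \<subseteq> F"
  proof
    fix x assume "x \<in> K"
    then obtain g :: "nat \<Rightarrow> 'a" and l :: nat where x: "x = cross_number G g {1..l}" and u: "ufim G g {1..l}"
      by (auto simp: K_def)
    have gc: "g \<in> {1..l} \<rightarrow> carrier G" using u by (auto simp: ufim_def)
    have "l = card (\<Union>a\<in>carrier G. {i \<in> {1..l}. g i = a})"
    proof -
      have "(\<Union>a\<in>carrier G. {i \<in> {1..l}. g i = a}) = {1..l}" using gc by auto
      then show ?thesis by simp
    qed
    also have "\<dots> \<le> (\<Sum>a\<in>carrier G. card {i \<in> {1..l}. g i = a})"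
      by (rule card_UN_le[OF fin])
    also have "\<dots> \<le> N"
      unfolding N_def by (intro sum_mono ufim_card_fibre_le_ord[OF assms(1) fin u])
    finally have "l \<le> N" .
    moreover have "x = cross_number G (restrict g {1..l}) {1..l}"
      unfolding x cross_number_def by (intro sum.cong) auto
    moreover have "restrict g {1..l} \<in> {1..l} \<rightarrow>\<^sub>E carrier G" using gc by auto
    ultimately show "x \<in> F" unfolding F_def by blast
  qed
  moreover have "finite F"
    unfolding F_def using fin by (auto intro!: finite_PiE)
  ultimately show "finite K" by (rule finite_subset)
  have "ufim G g {1..0::nat}" for g
    by (auto simp: ufim_def zero_sum_def irreducible_factorization_def partition_on_empty)
  then show "K \<noteq> {}" unfolding K_def by blast
qed

definition cyclic_power :: "nat \<Rightarrow> nat \<Rightarrow> (nat \<Rightarrow> int) monoid" where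
  "cyclic_power k n = product_group {1..n} (\<lambda>_. integer_mod_group k)"

end

theory Submission
  imports Defs
begin

text \<open>A zero-sum multiset without zeros is a UFIM iff its zero-sum submultisets are closed under
  intersection. Hence replacing any submultiset by its sum, if that sum is nonzero, gives a UFIM again.
  In $G = C_{p^m} \oplus C_r^n$ let $N_k$ be the subgroup of all $(a, b)$ with $p^{m-k}$ dividing $a$.
  Merging elements of $N_k$ outside $N_{k-1}$ turns a UFIM over $N_k$ into one over $N_{k-1}$
  while the cross number drops by at most $1/p^{k-1}$: what cannot be merged for free is essentially a UFIM
  over $N_k/N_{k-1}$, a group of order $p$, and a UFIM has at most as many elements as the group.
  For $r \neq p$ one descends to $N_0$, isomorphic to $C_r^n$, for $r = p$ to $N_1$, isomorphic to
  $C_p^{n+1}$. The total loss is compared with the lower bound $1 + 1/p + \dots + 1/p^{m-1}$ for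
  $K_1(C_{p^m})$.\<close>

section \<open>UFIMs and intersections of zero-sum subsets\<close>

text \<open>The obstacle is r different from p. Outside N_{k-1} an element has order at least p^k,
  and at least p^k r if its second component is nonzero; inside, the bounds are at most p^{k-1} and
  p^{k-1} r. A merge is free if the new element makes up for the at most p elements it replaces. For
  a set mixing both kinds it may not: elements of order p^k may be traded for a sum of order p^{k-1}
  r. So the two kinds are merged separately. When both are exhausted, each has at most p elements,
  which contribute at most 1/p^{k-1} and 1/(p^{k-1} r). A last merge across the kinds returns the
  second amount; if none exists, the two kinds together have at most p elements. Either way the step
  costs at most 1/p^{k-1}. The losses 1, 1/p, ..., 1/p^{m-1} add up to the lower bound for
  K_1(C_{p^m}), so its exact value is never computed. For r = p the step into N_0 is left out, and
  the loss of 1 saved there is the -1 in the estimate.\<close>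

text \<open>With \<open>N\<close> trivial this is the criterion for uniqueness of the factorization;
  for larger \<open>N\<close> it is the same condition on the image in the quotient by
  \<open>N\<close>, expressed without forming that quotient. The sum of \<open>I\<close> itself is
  left free, so the condition passes to all submultisets.\<close>

definition inter_closed ::
  "('a, 'b) monoid_scheme \<Rightarrow> 'a set \<Rightarrow> ('i \<Rightarrow> 'a) \<Rightarrow> 'i set \<Rightarrow> bool" where
  "inter_closed G N g I \<longleftrightarrow>
     (\<forall>J K. J \<subseteq> I \<and> K \<subseteq> I \<and> finprod G g J \<in> N \<and> finprod G g K \<in> N
        \<longrightarrow> finprod G g (J \<inter> K) \<in> N)"

lemma inter_closedD:
  assumes "inter_closed G N g I" "J \<subseteq> I" "K \<subseteq> I" "finprod G g J \<in> N" "finprod G g K \<in> N"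
  shows "finprod G g (J \<inter> K) \<in> N"
  using assms unfolding inter_closed_def by blast

text \<open>An inclusion-minimal nonempty \<open>Z\<close>-set is split off; what remains is again a
  \<open>Z\<close>-set because \<open>Z\<close> is closed under differences of nested sets.
  \<open>Z\<close> will mean that the sum lies in a given subgroup.\<close>

lemma minimal_partition_exists:
  assumes "finite I" "Z I" "\<And>J K. J \<subseteq> K \<Longrightarrow> K \<subseteq> I \<Longrightarrow> Z J \<Longrightarrow> Z K \<Longrightarrow> Z (K - J)"
  shows "\<exists>P. partition_on I P \<and> (\<forall>B\<in>P. Z B \<and> (\<forall>J. J \<noteq> {} \<and> J \<subset> B \<longrightarrow> \<not> Z J))"
  using assms
proof (induction I rule: finite_psubset_induct)
  case (psubset I)
  show ?case
  proof (cases "I = {}")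
    case True
    then show ?thesis by (intro exI[of _ "{}"]) (simp add: partition_on_empty)
  next
    case False
    define \<A> where "\<A> = {J. J \<noteq> {} \<and> J \<subseteq> I \<and> Z J}"
    have "finite \<A>" using psubset.hyps by (simp add: \<A>_def)
    moreover have "I \<in> \<A>" using False psubset.prems by (simp add: \<A>_def)
    ultimately obtain B where B: "B \<in> \<A>" "\<forall>J\<in>\<A>. J \<subseteq> B \<longrightarrow> B = J"
      using finite_has_minimal[of \<A>] by blast
    have BI: "B \<subseteq> I" "B \<noteq> {}" "Z B" using B(1) by (auto simp: \<A>_def)
    have "\<exists>P. partition_on (I - B) P \<and> (\<forall>B\<in>P. Z B \<and> (\<forall>J. J \<noteq> {} \<and> J \<subset> B \<longrightarrow> \<not> Z J))"
    proof (rule psubset.IH)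
      show "I - B \<subset> I" using BI by blast
      show "Z (I - B)" using psubset.prems BI by blast
      show "Z (K - J)" if "J \<subseteq> K" "K \<subseteq> I - B" "Z J" "Z K" for J K
        using psubset.prems(2)[of J K] that by blast
    qed
    then obtain P where
      P': "partition_on (I - B) P \<and> (\<forall>B\<in>P. Z B \<and> (\<forall>J. J \<noteq> {} \<and> J \<subset> B \<longrightarrow> \<not> Z J))" ..
    note P = conjunct1[OF P'] conjunct2[OF P']
    have "partition_on I (insert B P)"
    proof -
      have "disjnt B (\<Union>P)" unfolding partition_onD1[OF P(1), symmetric] by (simp add: disjnt_def)
      then show ?thesis using P(1) BI by (simp add: partition_on_insert)
    qed
    moreover have "\<not> Z J" if "J \<noteq> {} \<and> J \<subset> B" for J
    proof
      assume "Z J"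
      then have "J \<in> \<A>" using that BI by (auto simp: \<A>_def)
      then show False using B(2) that by blast
    qed
    then have "\<forall>C\<in>insert B P. Z C \<and> (\<forall>J. J \<noteq> {} \<and> J \<subset> C \<longrightarrow> \<not> Z J)"
      using P(2) BI(3) by simp
    ultimately show ?thesis by (intro exI conjI)
  qed
qed

context comm_group
begin

lemma finprod_Diff:
  assumes "finite I" "g \<in> I \<rightarrow> carrier G" "J \<subseteq> I" "K \<subseteq> J"
  shows "finprod G g J = finprod G g K \<otimes> finprod G g (J - K)"
proof -
  have "K \<union> (J - K) = J" using assms by blast
  moreover have "finprod G g (K \<union> (J - K)) = finprod G g K \<otimes> finprod G g (J - K)"
    using assms by (intro finprod_Un_disjoint) (auto intro: finite_subset)
  ultimately show ?thesis by simp
qed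

lemma finprod_sub_closed:
  assumes "g \<in> I \<rightarrow> carrier G" "J \<subseteq> I"
  shows "finprod G g J \<in> carrier G"
  using assms by (intro finprod_closed) auto

lemma subgroup_mult_iff:
  assumes "subgroup N G" "x \<in> carrier G" "y \<in> N"
  shows "y \<otimes> x \<in> N \<longleftrightarrow> x \<in> N"
proof
  assume a: "y \<otimes> x \<in> N"
  have "inv y \<otimes> (y \<otimes> x) = x"
    using assms subgroup.mem_carrier[OF assms(1,3)] by (simp add: m_assoc[symmetric])
  then show "x \<in> N" using a assms by (metis subgroup.m_closed subgroup.m_inv_closed)
qed (rule subgroup.m_closed[OF assms(1,3)])

lemma finprod_Diff_mem:
  assumes "subgroup N G" "finite I" "g \<in> I \<rightarrow> carrier G" "J \<subseteq> I" "K \<subseteq> J" "finprod G g K \<in> N"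
  shows "finprod G g (J - K) \<in> N \<longleftrightarrow> finprod G g J \<in> N"
  using finprod_Diff[OF assms(2-5)] subgroup_mult_iff[OF assms(1) _ assms(6)]
    finprod_sub_closed[OF assms(3), of "J - K"] assms(4) by fastforce

lemma finprod_mem:
  assumes "subgroup N G" "g \<in> I \<rightarrow> N"
  shows "finprod G g I \<in> N"
proof -
  have "N \<subseteq> carrier G" using assms(1) by (rule subgroup.subset)
  show ?thesis using assms(2)
  proof (induction I rule: infinite_finite_induct)
    case (insert x F)
    then have "finprod G g (insert x F) = g x \<otimes> finprod G g F"
      using \<open>N \<subseteq> carrier G\<close> by (intro finprod_insert) auto
    then show ?case using insert subgroup.m_closed[OF assms(1)] by simp
  qed (simp_all add: subgroup.one_closed[OF assms(1)])
qed

lemma minimal_partition_mod: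
  assumes "subgroup N G" "finite I" "g \<in> I \<rightarrow> carrier G" "finprod G g I \<in> N"
  shows "\<exists>P. partition_on I P \<and>
    (\<forall>B\<in>P. finprod G g B \<in> N \<and> (\<forall>J. J \<noteq> {} \<and> J \<subset> B \<longrightarrow> finprod G g J \<notin> N))"
proof (rule minimal_partition_exists)
  show "finprod G g (K - J) \<in> N"
    if "J \<subseteq> K" "K \<subseteq> I" "finprod G g J \<in> N" "finprod G g K \<in> N" for J K
    using finprod_Diff_mem[OF assms(1-3)] that by blast
qed (use assms in auto)

lemma irreducible_factorization_exists:
  assumes "finite I" "g \<in> I \<rightarrow> carrier G" "zero_sum G g I"
  shows "\<exists>P. irreducible_factorization G g I P"
  using minimal_partition_mod[OF triv_subgroup assms(1,2)] assms(3)
  unfolding irreducible_factorization_def minimal_zero_sum_def zero_sum_def by auto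

lemma finprod_partition_mem:
  assumes "subgroup N G" "finite I" "g \<in> I \<rightarrow> carrier G" "partition_on I P" "Q \<subseteq> P"
    "\<And>B. B \<in> Q \<Longrightarrow> finprod G g B \<in> N"
  shows "finprod G g (\<Union>Q) \<in> N"
proof -
  have P: "\<Union>P = I" "disjoint P" using assms by (auto simp: partition_on_def)
  have "finprod G g (\<Union>Q) = finprod G (finprod G g) Q"
  proof (rule finprod_Union_disjoint)
    show "finite Q" using finite_elements[OF assms(2,4)] assms(5) by (rule rev_finite_subset)
    show "pairwise disjnt Q"
      using P assms(5) by (auto simp: pairwise_def disjnt_def disjoint_def)
    show "finite A \<and> (\<forall>x\<in>A. g x \<in> carrier G)" if "A \<in> Q" for A
    proof -
      have "A \<subseteq> I" using that assms(5) P by blast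
      then show ?thesis using assms(2,3) finite_subset by blast
    qed
  qed
  also have "\<dots> \<in> N" using assms(6) by (intro finprod_mem[OF assms(1)]) auto
  finally show ?thesis .
qed

text \<open>Factorizing a zero-sum \<open>J\<close> and its complement separately and joining the
  results gives a factorization of \<open>I\<close>, which must be the unique \<open>P\<close>. So
  the zero-sum subsets are the unions of blocks of \<open>P\<close>, and such unions are closed
  under intersection.\<close>

lemma ufim_inter_closed:
  assumes "ufim G g I"
  shows "inter_closed G {\<one>} g I"
proof -
  have fin: "finite I" and g: "g \<in> I \<rightarrow> carrier G" and z: "finprod G g I = \<one>"
    using assms by (auto simp: ufim_def zero_sum_def)
  obtain P where P: "irreducible_factorization G g I P"
    and uniq: "\<And>Q. irreducible_factorization G g I Q \<Longrightarrow> Q = P"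
    using assms unfolding ufim_def by (elim conjE ex1E) metis
  have union: "\<exists>Q\<subseteq>P. J = \<Union>Q" if J: "J \<subseteq> I" "finprod G g J = \<one>" for J
  proof -
    have "finprod G g (I - J) = \<one>"
      using finprod_Diff_mem[OF triv_subgroup fin g order_refl, of J] J z by auto
    then obtain Q R where QR: "irreducible_factorization G g J Q" "irreducible_factorization G g (I - J) R"
      using irreducible_factorization_exists[of J g] irreducible_factorization_exists[of "I - J" g]
        J fin g finite_subset[OF J(1)] by (fastforce simp: zero_sum_def)
    have "partition_on (J \<union> (I - J)) (Q \<union> R)"
    proof (rule partition_onI)
      have p: "partition_on J Q" "partition_on (I - J) R"
        using QR by (auto simp: irreducible_factorization_def)
      then have u: "\<Union>Q = J" "\<Union>R = I - J" by (auto simp: partition_on_def)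
      then show "\<Union>(Q \<union> R) = J \<union> (I - J)" by simp
      show "{} \<notin> Q \<union> R" using p by (auto simp: partition_on_def)
      show "disjnt X Y" if XY: "X \<in> Q \<union> R" "Y \<in> Q \<union> R" "X \<noteq> Y" for X Y
      proof -
        have "disjnt X Y" if "X \<in> Q \<and> Y \<in> Q \<or> X \<in> R \<and> Y \<in> R"
          using that p XY by (auto simp: partition_on_def pairwise_def)
        moreover have "disjnt X Y" if "X \<in> Q \<and> Y \<in> R \<or> X \<in> R \<and> Y \<in> Q"
          using that u unfolding disjnt_def by blast
        ultimately show ?thesis using XY by blast
      qed
    qed
    moreover have "J \<union> (I - J) = I" using J by blast
    ultimately have "irreducible_factorization G g I (Q \<union> R)"
      using QR unfolding irreducible_factorization_def by auto
    then have "Q \<union> R = P" by (rule uniq)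
    moreover have "J = \<Union>Q" using QR by (auto simp: irreducible_factorization_def partition_on_def)
    ultimately show ?thesis by blast
  qed
  have part: "partition_on I P" and b: "\<And>B. B \<in> P \<Longrightarrow> finprod G g B = \<one>"
    using P by (auto simp: irreducible_factorization_def minimal_zero_sum_def zero_sum_def)
  have "finprod G g (J \<inter> K) = \<one>"
    if JK: "J \<subseteq> I" "K \<subseteq> I" "finprod G g J = \<one>" "finprod G g K = \<one>" for J K
  proof -
    obtain Q where Q: "Q \<subseteq> P" "J = \<Union>Q" using union[OF JK(1,3)] by (elim exE conjE)
    obtain R where R: "R \<subseteq> P" "K = \<Union>R" using union[OF JK(2,4)] by (elim exE conjE)
    note QR = Q R
    have "J \<inter> K = \<Union>(Q \<inter> R)"
    proof
      show "J \<inter> K \<subseteq> \<Union>(Q \<inter> R)"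
      proof
        fix x assume "x \<in> J \<inter> K"
        then obtain X Y where XY: "X \<in> Q" "Y \<in> R" "x \<in> X" "x \<in> Y" using QR by auto
        then have "X = Y"
          using QR pairwiseD[OF partition_onD2[OF part], of X Y] by (auto simp: disjnt_def)
        then show "x \<in> \<Union>(Q \<inter> R)" using XY by auto
      qed
      show "\<Union>(Q \<inter> R) \<subseteq> J \<inter> K" using QR by auto
    qed
    moreover have "finprod G g (\<Union>(Q \<inter> R)) \<in> {\<one>}"
    proof (rule finprod_partition_mem[OF triv_subgroup fin g part])
      show "Q \<inter> R \<subseteq> P" using Q(1) by (rule le_infI1)
      show "finprod G g B \<in> {\<one>}" if "B \<in> Q \<inter> R" for B
        using that Q(1) b[of B] by auto
    qed
    ultimately show ?thesis by simp
  qed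
  then show ?thesis by (auto simp: inter_closed_def)
qed

text \<open>For the converse, if blocks of two factorizations share an index, their intersection is
  a nonempty zero-sum subset of both, and minimality forces both to equal it. UFIMs thereby become a
  condition on sums alone, which merging, reindexing and injective homomorphisms preserve.\<close>

lemma ufim_iff_inter_closed:
  "ufim G g I \<longleftrightarrow> finite I \<and> g \<in> I \<rightarrow> carrier G - {\<one>} \<and> finprod G g I = \<one> \<and> inter_closed G {\<one>} g I"
proof (intro iffI conjI)
  assume *: "finite I \<and> g \<in> I \<rightarrow> carrier G - {\<one>} \<and> finprod G g I = \<one> \<and> inter_closed G {\<one>} g I"
  have sub: "P \<subseteq> P'" if P: "irreducible_factorization G g I P" and P': "irreducible_factorization G g I P'" for P P'
  proof
    fix B assume B: "B \<in> P"
    have "\<Union>P = I" "{} \<notin> P" "\<Union>P' = I"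
      using P P' by (auto simp: irreducible_factorization_def partition_on_def)
    then obtain x B' where x: "x \<in> B" and B': "B' \<in> P'" "x \<in> B'"
      using B by (metis UnionE UnionI equals0I)
    have m: "minimal_zero_sum G g B" "minimal_zero_sum G g B'" "B \<subseteq> I" "B' \<subseteq> I"
      using B B' P P' by (auto simp: irreducible_factorization_def partition_on_def)
    have "finprod G g (B \<inter> B') \<in> {\<one>}"
      using * m by (intro inter_closedD[of G "{\<one>}" g I]) (auto simp: minimal_zero_sum_def zero_sum_def)
    then have z: "zero_sum G g (B \<inter> B')" by (simp add: zero_sum_def)
    have ne: "B \<inter> B' \<noteq> {}" using x B'(2) by auto
    have "B \<inter> B' = X" if "minimal_zero_sum G g X" "B \<inter> B' \<subseteq> X" for X
      using that z ne unfolding minimal_zero_sum_def by (metis psubsetI)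
    from this[OF m(1) Int_lower1] this[OF m(2) Int_lower2] have "B = B'" by simp
    then show "B \<in> P'" using B'(1) by simp
  qed
  have "\<exists>P. irreducible_factorization G g I P"
    using * by (intro irreducible_factorization_exists) (auto simp: zero_sum_def)
  then obtain P where P: "irreducible_factorization G g I P" ..
  then have "\<exists>!P. irreducible_factorization G g I P"
    by (rule ex1I) (intro subset_antisym sub P)
  then show "ufim G g I" unfolding ufim_def zero_sum_def using * by simp
next
  assume "ufim G g I"
  then show "inter_closed G {\<one>} g I" by (rule ufim_inter_closed)
qed (auto simp: ufim_def zero_sum_def)

end

section \<open>Size bound relative to a subgroup\<close>

text \<open>Repeated use of a + b \<le> a b for a, b \<ge> 2. It turns a bound on the product of the
  block sizes into one on their sum.\<close>

lemma sum_le_prod_nat: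
  fixes f :: "'b \<Rightarrow> nat"
  assumes "finite A" "\<And>x. x \<in> A \<Longrightarrow> f x \<ge> 2"
  shows "sum f A \<le> prod f A"
  using assms
proof (induction A rule: finite_induct)
  case (insert x A)
  show ?case
  proof (cases "A = {}")
    case False
    then obtain y where y: "y \<in> A" by blast
    have "2 \<le> f y" using insert.prems y by simp
    also have "\<dots> \<le> sum f A" by (rule member_le_sum) (use y insert.hyps in auto)
    also have "\<dots> \<le> prod f A" using insert by simp
    finally obtain a b where ab: "prod f A = a + 2" "f x = b + 2"
      using insert.prems by (metis add.commute insertI1 le_Suc_ex)
    then have "f x + prod f A \<le> f x * prod f A" by (simp add: algebra_simps)
    then show ?thesis using insert by simp
  qed simp
qed simp

text \<open>The labelling \<open>c\<close> replaces the quotient map from \<open>M\<close> to \<open>M/N\<close>; the size of \<open>C\<close> bounds the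
  index.\<close>

locale coset_labelling = comm_group +
  fixes N M :: "'a set" and c :: "'a \<Rightarrow> 'c" and C :: "'c set"
  assumes N: "subgroup N G" and M: "subgroup M G" and N_sub_M: "N \<subseteq> M"
    and finite_C: "finite C" and c_mem: "c \<in> M \<rightarrow> C"
    and c_eq: "\<And>x y. x \<in> M \<Longrightarrow> y \<in> M \<Longrightarrow> c x = c y \<Longrightarrow> x \<otimes> inv y \<in> N"
begin

lemma M_carrier: "M \<subseteq> carrier G"
  using M by (rule subgroup.subset)

lemma N_carrier: "N \<subseteq> carrier G"
  using N by (rule subgroup.subset)

lemma finprod_mem_M: "g \<in> I \<rightarrow> M \<Longrightarrow> J \<subseteq> I \<Longrightarrow> finprod G g J \<in> M"
  using finprod_mem[OF M] by (metis Pi_anti_mono subsetD)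

text \<open>The formal combination X - Y + W has its sum in \<open>N\<close>. The last two
  assumptions say that its coefficients are 0 or 1: each -1 on \<open>Y - X\<close> is cancelled by
  \<open>W\<close>, and \<open>W\<close> avoids \<open>X - Y\<close>. So it is a genuine subset, the
  one in the conclusion.\<close>

lemma finprod_exchange:
  assumes "finite I" "g \<in> I \<rightarrow> M" "X \<subseteq> I" "Y \<subseteq> I" "W \<subseteq> I"
    and "c (finprod G g X) = c (finprod G g Y)" "finprod G g W \<in> N"
    and "Y - X \<subseteq> W" "W \<inter> (X - Y) = {}"
  shows "finprod G g ((X - Y) \<union> (W - (Y - X))) \<in> N"
proof -
  have gG: "g \<in> I \<rightarrow> carrier G" using assms(2) M_carrier by auto
  let ?s = "finprod G g"
  have cl: "?s K \<in> carrier G" if "K \<subseteq> I" for K using finprod_sub_closed[OF gG that] .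
  have s: "X - Y \<subseteq> I" "Y - X \<subseteq> I" "X \<inter> Y \<subseteq> I" "W - (Y - X) \<subseteq> I" using assms by auto
  note cls = cl[OF s(1)] cl[OF s(2)] cl[OF s(3)] cl[OF s(4)] cl[OF assms(3)] cl[OF assms(4)]
  have X: "?s X = ?s (X \<inter> Y) \<otimes> ?s (X - Y)"
    using finprod_Diff[OF assms(1) gG assms(3), of "X \<inter> Y"] by (simp add: Diff_Int)
  have Y: "?s Y = ?s (X \<inter> Y) \<otimes> ?s (Y - X)"
    using finprod_Diff[OF assms(1) gG assms(4), of "X \<inter> Y"] by (simp add: Diff_Int)
  have W: "?s W = ?s (Y - X) \<otimes> ?s (W - (Y - X))"
    by (rule finprod_Diff[OF assms(1) gG assms(5,8)])
  have "?s X \<otimes> inv (?s Y) \<in> N"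
    using assms finprod_mem_M by (intro c_eq) auto
  then have "(?s X \<otimes> inv (?s Y)) \<otimes> ?s W \<in> N"
    using assms(7) subgroup.m_closed[OF N] by simp
  moreover have "(?s X \<otimes> inv (?s Y)) \<otimes> ?s W = ?s (X - Y) \<otimes> ?s (W - (Y - X))"
  proof -
    have ac: "u \<otimes> a \<otimes> v \<otimes> (b \<otimes> w) = (u \<otimes> b \<otimes> v) \<otimes> (a \<otimes> w)"
      if "u \<in> carrier G" "a \<in> carrier G" "b \<in> carrier G" "w \<in> carrier G" "v \<in> carrier G"
      for u a b w v
      using that by (simp add: m_ac)
    have "u \<otimes> a \<otimes> inv (u \<otimes> b) \<otimes> (b \<otimes> w) = a \<otimes> w"
      if "u \<in> carrier G" "a \<in> carrier G" "b \<in> carrier G" "w \<in> carrier G" for u a b w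
    proof -
      have v: "inv (u \<otimes> b) \<in> carrier G" using that by simp
      have "u \<otimes> a \<otimes> inv (u \<otimes> b) \<otimes> (b \<otimes> w) = (u \<otimes> b \<otimes> inv (u \<otimes> b)) \<otimes> (a \<otimes> w)"
        using ac[OF that v] .
      then show ?thesis using that by simp
    qed
    then show ?thesis unfolding X Y W using cls by blast
  qed
  moreover have "?s ((X - Y) \<union> (W - (Y - X))) = ?s (X - Y) \<otimes> ?s (W - (Y - X))"
    using assms(1,9) s gG by (intro finprod_Un_disjoint) (auto intro: finite_subset)
  ultimately show ?thesis by simp
qed

text \<open>Pigeonhole on the initial segments of lengths 0 to \<open>card C\<close> of an
  enumeration: the sums of two of them have the same label, so the difference of the two segments
  has its sum in \<open>N\<close>. Stopping at length \<open>card C\<close> keeps this difference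
  proper.\<close>

lemma zero_sum_mod_proper_subset:
  assumes "finite J" "card C < card J" "g \<in> J \<rightarrow> M"
  shows "\<exists>K. K \<noteq> {} \<and> K \<subset> J \<and> finprod G g K \<in> N"
proof -
  obtain e where e: "bij_betw e {0..<card J} J"
    using ex_bij_betw_nat_finite[OF assms(1)] by blast
  define E where "E = (\<lambda>j. e ` {0..<j})"
  have EJ: "E j \<subseteq> J" if "j \<le> card C" for j
    using that assms(2) e unfolding E_def bij_betw_def by auto
  have "(\<lambda>j. c (finprod G g (E j))) ` {..card C} \<subseteq> C"
    using EJ finprod_mem_M[OF assms(3)] c_mem by auto
  then have "card ((\<lambda>j. c (finprod G g (E j))) ` {..card C}) < card {..card C}"
    using card_mono[OF finite_C] by (simp add: le_imp_less_Suc)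
  then have "\<not> inj_on (\<lambda>j. c (finprod G g (E j))) {..card C}" by (rule pigeonhole)
  then obtain i j where ij: "i < j" "j \<le> card C" "c (finprod G g (E j)) = c (finprod G g (E i))"
    by (auto simp: inj_on_def) (metis linorder_neqE_nat)
  have "E i \<subseteq> E j" using ij(1) by (auto simp: E_def)
  then have "E i - E j = {}" by auto
  then have "finprod G g (E j - E i) \<in> N"
    using finprod_exchange[OF assms(1,3) EJ[OF ij(2)] EJ[of i] empty_subsetI ij(3)] ij
    by (simp add: subgroup.one_closed[OF N])
  moreover have "e i \<in> E j - E i"
  proof -
    have "e i \<noteq> e k" if "k < i" for k
      using inj_onD[OF bij_betw_imp_inj_on[OF e], of i k] that ij assms(2) by auto
    then have "e i \<notin> E i" by (auto simp: E_def) metis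
    moreover have "e i \<in> E j" using ij(1) by (auto simp: E_def)
    ultimately show ?thesis by simp
  qed
  moreover have "card (E j - E i) < card J"
  proof -
    have "card (E j - E i) \<le> card (E j)" by (intro card_mono) (auto simp: E_def)
    also have "\<dots> \<le> j" unfolding E_def using card_image_le[of "{0..<j}" e] by simp
    finally show ?thesis using ij assms(2) by linarith
  qed
  moreover have "E j - E i \<subseteq> J" using EJ[OF ij(2)] by auto
  ultimately show ?thesis by (intro exI[of _ "E j - E i"]) auto
qed

text \<open>Choosing an initial segment of every minimal block gives sums in pairwise distinct cosets;
  so the product of the block sizes, hence their sum, is bounded by the index.\<close>

lemma card_le_index_of_zero_sum:
  assumes fin: "finite I" and g: "g \<in> I \<rightarrow> M - N" and z: "finprod G g I \<in> N"
    and ic: "inter_closed G N g I"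
  shows "card I \<le> card C"
proof -
  have gM: "g \<in> I \<rightarrow> M" using g by auto
  have gG: "g \<in> I \<rightarrow> carrier G" using gM M_carrier by auto
  obtain P where P: "partition_on I P \<and>
      (\<forall>B\<in>P. finprod G g B \<in> N \<and> (\<forall>J. J \<noteq> {} \<and> J \<subset> B \<longrightarrow> finprod G g J \<notin> N))"
    using minimal_partition_mod[OF N fin gG z] ..
  note part = conjunct1[OF P]
  have BN: "finprod G g B \<in> N" if "B \<in> P" for B using P that by simp
  have Bmin: False if "B \<in> P" "J \<noteq> {}" "J \<subset> B" "finprod G g J \<in> N" for B J
    using P that by simp
  have UP: "\<Union>P = I" and ne: "{} \<notin> P" and dis: "disjoint P"
    using part by (auto simp: partition_on_def)
  have finP: "finite P" using finite_elements[OF fin part] .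
  have BI: "B \<subseteq> I" if "B \<in> P" for B using UP that by auto
  have finB: "finite B" if "B \<in> P" for B using BI[OF that] fin by (rule finite_subset)
  have same: "B = B'" if "B \<in> P" "B' \<in> P" "x \<in> B" "x \<in> B'" for B B' x
    using pairwiseD[OF dis that(1,2)] that(3,4) by (auto simp: disjnt_def)
  have two: "2 \<le> card B" if B: "B \<in> P" for B
  proof (rule ccontr)
    assume "\<not> 2 \<le> card B"
    moreover have "card B \<noteq> 0" using B ne finB by auto
    ultimately have "card B = 1" by simp
    then obtain x where x: "B = {x}" by (auto simp: card_1_singleton_iff)
    then have "g x \<in> M - N" using BI[OF B] g by auto
    then show False using BN[OF B] M_carrier x by auto
  qed
  have "\<forall>B\<in>P. \<exists>e. bij_betw e {0..<card B} B"
    using ex_bij_betw_nat_finite finB by blast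
  then obtain e where e: "\<And>B. B \<in> P \<Longrightarrow> bij_betw (e B) {0..<card B} B" by metis
  define S where "S = (\<lambda>f B. e B ` {0..<f B :: nat})"
  define U where "U = (\<lambda>f. \<Union>B\<in>P. S f B)"
  \<comment> \<open>\<open>f B\<close> counts the elements of the block \<open>B\<close> that go
    into \<open>U f\<close>. The value \<open>card B\<close> is excluded because a full block lies
    in the same coset as an empty one; this leaves \<open>card B\<close> choices per block.\<close>
  define F where "F = (\<Pi>\<^sub>E B\<in>P. {0..<card B})"
  have SB: "S f B \<subseteq> B" if "f \<in> F" "B \<in> P" for f B
  proof -
    have "f B < card B" using that by (auto simp: F_def)
    then show ?thesis using e[OF that(2)] by (auto simp: S_def bij_betw_def)
  qed
  have UB: "x \<in> U f \<longleftrightarrow> x \<in> S f B" if "f \<in> F" "B \<in> P" "x \<in> B" for f B x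
  proof
    assume "x \<in> U f"
    then obtain B' where "B' \<in> P" "x \<in> S f B'" by (auto simp: U_def)
    then show "x \<in> S f B" using SB that same[of B B' x] by auto
  qed (use that in \<open>auto simp: U_def\<close>)
  have UI: "U f \<subseteq> I" if "f \<in> F" for f using SB[OF that] BI by (fastforce simp: U_def)
  have eS: "e B i \<in> S f B \<longleftrightarrow> i < f B" if "f \<in> F" "B \<in> P" "i < card B" for f B i
  proof -
    have "f B < card B" using that by (auto simp: F_def)
    then show ?thesis
      using inj_on_image_mem_iff[OF bij_betw_imp_inj_on[OF e[OF that(2)]], of i "{0..<f B}"] that(3)
      by (auto simp: S_def)
  qed
  have le: "f B \<le> f' B" if f: "f \<in> F" "f' \<in> F" and c: "c (finprod G g (U f)) = c (finprod G g (U f'))"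
    and B: "B \<in> P" for f f' B
  proof (rule ccontr)
    assume less: "\<not> f B \<le> f' B"
    \<comment> \<open>On the blocks of \<open>Q\<close> the difference of \<open>U f\<close> and
      \<open>U f'\<close> is negative. Adding these whole blocks, whose sums lie in
      \<open>N\<close>, turns it into a genuine subset \<open>Y\<close>.\<close>
    define Q where "Q = {B \<in> P. f B < f' B}"
    define Y where "Y = (U f - U f') \<union> (\<Union>Q - (U f' - U f))"
    have QI: "\<Union>Q \<subseteq> I" using UP by (auto simp: Q_def)
    have "finprod G g Y \<in> N"
      unfolding Y_def
    proof (rule finprod_exchange[OF fin gM UI[OF f(1)] UI[OF f(2)] QI c])
      show "finprod G g (\<Union>Q) \<in> N"
        by (rule finprod_partition_mem[OF N fin gG part]) (auto simp: Q_def BN)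
      have mono: "S f B \<subseteq> S f' B" if "f B \<le> f' B" for f f' :: "_ \<Rightarrow> nat" and B
        using that by (auto simp: S_def)
      show "U f' - U f \<subseteq> \<Union>Q"
      proof
        fix x assume x: "x \<in> U f' - U f"
        then obtain B where B: "B \<in> P" "x \<in> S f' B" by (auto simp: U_def)
        then have "x \<notin> S f B" using x by (auto simp: U_def)
        then have "B \<in> Q" using mono[of f' B f] B by (force simp: Q_def)
        then show "x \<in> \<Union>Q" using SB[OF f(2) B(1)] B(2) by auto
      qed
      show "\<Union>Q \<inter> (U f - U f') = {}"
      proof -
        have False if "x \<in> B" "B \<in> Q" "x \<in> U f" "x \<notin> U f'" for x B
          using that UB[OF f(1)] UB[OF f(2)] mono[of f B f'] by (auto simp: Q_def)
        then show ?thesis by auto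
      qed
    qed
    moreover have "Y \<subseteq> I" using UI f QI by (auto simp: Y_def)
    \<comment> \<open>Intersecting \<open>Y\<close> with \<open>B\<close> isolates the single
      segment \<open>S f B - S f' B\<close>, which will contradict the minimality of
      \<open>B\<close>.\<close>
    ultimately have YN: "finprod G g (Y \<inter> B) \<in> N"
      using inter_closedD[OF ic _ BI[OF B]] BN[OF B] by simp
    have "B \<notin> Q" using less by (simp add: Q_def)
    have BQ: "x \<notin> \<Union>Q" if x: "x \<in> B" for x
    proof
      assume "x \<in> \<Union>Q"
      then obtain B' where B': "B' \<in> Q" "x \<in> B'" by (elim UnionE)
      then have "B' \<in> P" by (simp add: Q_def)
      then have "B = B'" using same[OF B _ x B'(2)] by simp
      then show False using \<open>B \<notin> Q\<close> B'(1) by simp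
    qed
    have YB: "Y \<inter> B = S f B - S f' B"
    proof
      show "Y \<inter> B \<subseteq> S f B - S f' B"
        using BQ UB[OF f(1) B] UB[OF f(2) B] by (auto simp: Y_def simp del: Union_iff)
      show "S f B - S f' B \<subseteq> Y \<inter> B"
        using UB[OF f(1) B] UB[OF f(2) B] SB[OF f(1) B] by (auto simp: Y_def)
    qed
    \<comment> \<open>Position \<open>f' B\<close> shows that the segment is nonempty; position
      \<open>f B\<close>, still inside the block, shows that it is proper.\<close>
    have "f B < card B" using f B by (auto simp: F_def)
    then have "e B (f' B) \<in> S f B - S f' B" "e B (f B) \<in> B - S f B"
      using eS[OF f(1) B] eS[OF f(2) B] less e[OF B] by (auto simp: bij_betw_def)
    then have "S f B - S f' B \<noteq> {}" "S f B - S f' B \<subset> B" using SB[OF f(1) B] by auto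
    then show False by (rule Bmin[OF B]) (rule YN[unfolded YB])
  qed
  have "inj_on (\<lambda>f. c (finprod G g (U f))) F"
  proof (rule inj_onI)
    fix f f' assume f: "f \<in> F" "f' \<in> F" and c: "c (finprod G g (U f)) = c (finprod G g (U f'))"
    have "f B = f' B" if "B \<in> P" for B
      using le[OF f c that] le[OF f(2,1) c[symmetric] that] by simp
    then show "f = f'" using f unfolding F_def by (intro PiE_ext) auto
  qed
  moreover have "(\<lambda>f. c (finprod G g (U f))) ` F \<subseteq> C"
    using finprod_mem_M[OF gM UI] c_mem by auto
  ultimately have "card F \<le> card C" using finite_C by (rule card_inj_on_le)
  moreover have "card F = (\<Prod>B\<in>P. card B)" unfolding F_def by (simp add: card_PiE[OF finP])
  moreover have "card I = (\<Sum>B\<in>P. card B)"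
    using card_Union_disjoint[OF dis finB] UP by simp
  ultimately show ?thesis using sum_le_prod_nat[OF finP, of card] two by simp
qed

text \<open>If the sum s of \<open>T\<close> is not in \<open>N\<close>, appending the inverse of s
  completes \<open>T\<close> to a multiset with trivial sum and one more element, to which the
  previous bound applies. The surrounding \<open>I\<close> supplies a free index: its own sum lies
  in \<open>N\<close>, so \<open>T\<close> differs from \<open>I\<close>.\<close>

lemma card_le_index:
  assumes fin: "finite I" and g: "g \<in> I \<rightarrow> M" and z: "finprod G g I \<in> N"
    and T: "T \<subseteq> I" "g \<in> T \<rightarrow> M - N" and ic: "inter_closed G N g T"
  shows "card T \<le> card C"
proof (cases "finprod G g T \<in> N")
  case True
  then show ?thesis using card_le_index_of_zero_sum[OF _ T(2) _ ic] T(1) fin finite_subset by metis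
next
  case False
  then have "T \<noteq> I" using z by metis
  then obtain j where j: "j \<in> I" "j \<notin> T" using T(1) by blast
  have finT: "finite T" using T(1) fin by (rule finite_subset)
  define s where "s = finprod G g T"
  have sM: "s \<in> M" unfolding s_def using finprod_mem_M[OF g T(1)] .
  then have sG: "s \<in> carrier G" using M_carrier by auto
  have sN: "s \<notin> N" using False by (simp add: s_def)
  define g' where "g' = g(j := inv s)"
  define T' where "T' = insert j T"
  have "inv s \<notin> N" using sN subgroup.m_inv_closed[OF N, of "inv s"] sG by auto
  then have g'T': "g' \<in> T' \<rightarrow> M - N"
    using T(2) j subgroup.m_inv_closed[OF M sM] by (auto simp: g'_def T'_def)
  then have g'G: "g' \<in> T' \<rightarrow> carrier G" using M_carrier by auto
  have gT: "g \<in> T \<rightarrow> carrier G" using T(2) M_carrier by auto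
  have eq: "finprod G g' K = finprod G g K" if "K \<subseteq> T" for K
    using that j gT by (intro finprod_cong') (auto simp: g'_def)
  have one: "finprod G g' T' = \<one>"
  proof -
    have "finprod G g' T' = g' j \<otimes> finprod G g' T"
      unfolding T'_def using finT j g'G by (intro finprod_insert) (auto simp: T'_def)
    then show ?thesis using eq[of T] sG by (simp add: g'_def s_def[symmetric])
  qed
  have finT': "finite T'" using finT by (simp add: T'_def)
  have N1: "\<one> \<in> N" by (rule subgroup.one_closed[OF N])
  have diff: "finprod G g' (J - K) \<in> N"
    if "K \<subseteq> J" "J \<subseteq> T'" "finprod G g' K \<in> N" "finprod G g' J \<in> N" for J K
    using finprod_Diff_mem[OF N finT' g'G that(2,1,3)] that(4) by simp
  \<comment> \<open>Sets containing the new index \<open>j\<close> are traded for their complements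
    in \<open>T'\<close>, which avoid \<open>j\<close> and have their sums in \<open>N\<close> too.
    The facts \<open>i1\<close>, \<open>i2\<close>, \<open>i3\<close> allow \<open>j\<close> in
    neither set, in the second one, and in both.\<close>
  have compl: "finprod G g' (T' - K) \<in> N" if "K \<subseteq> T'" "finprod G g' K \<in> N" for K
    using diff[OF that(1) order_refl that(2)] one N1 by simp
  have i1: "finprod G g' (J \<inter> K) \<in> N"
    if "J \<subseteq> T" "K \<subseteq> T" "finprod G g' J \<in> N" "finprod G g' K \<in> N" for J K
    using inter_closedD[OF ic that(1,2)] that eq[of J] eq[of K] eq[OF le_infI1[OF that(1)], of K] by simp
  have i2: "finprod G g' (J \<inter> K) \<in> N"
    if JK: "J \<subseteq> T" "K \<subseteq> T'" "finprod G g' J \<in> N" "finprod G g' K \<in> N" for J K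
  proof (cases "j \<in> K")
    case True
    then have "finprod G g' (J \<inter> (T' - K)) \<in> N"
      using JK by (intro i1 compl) (auto simp: T'_def)
    then have "finprod G g' (J - (J \<inter> (T' - K))) \<in> N"
      using JK by (intro diff) (auto simp: T'_def)
    moreover have "J - (J \<inter> (T' - K)) = J \<inter> K" using JK by (auto simp: T'_def)
    ultimately show ?thesis by simp
  qed (use i1[of J K] JK in \<open>auto simp: T'_def\<close>)
  have i3: "finprod G g' (J \<inter> K) \<in> N"
    if JK: "J \<subseteq> T'" "K \<subseteq> T'" "finprod G g' J \<in> N" "finprod G g' K \<in> N" for J K
  proof (cases "j \<in> J")
    case True
    then have "finprod G g' ((T' - J) \<inter> K) \<in> N"
      using JK by (intro i2 compl) (auto simp: T'_def)
    then have "finprod G g' (K - ((T' - J) \<inter> K)) \<in> N"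
      using JK by (intro diff) auto
    moreover have "K - ((T' - J) \<inter> K) = J \<inter> K" using JK by auto
    ultimately show ?thesis by simp
  qed (use i2[of J K] JK in \<open>auto simp: T'_def\<close>)
  have "card T' \<le> card C"
  proof (rule card_le_index_of_zero_sum[OF finT' g'T'])
    show "inter_closed G N g' T'" unfolding inter_closed_def using i3 by simp
  qed (simp add: one N1)
  then show ?thesis using finT j by (simp add: T'_def)
qed

end

section \<open>Merging and descent to a subgroup\<close>

lemma cross_number_Diff:
  assumes "finite I" "J \<subseteq> I"
  shows "cross_number G g I = cross_number G g (I - J) + cross_number G g J"
  unfolding cross_number_def using assms by (rule sum.subset_diff[rotated])

lemma cross_number_le:
  assumes "w > 0" "\<And>i. i \<in> J \<Longrightarrow> w \<le> real (group.ord G (g i))"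
  shows "cross_number G g J \<le> real (card J) / w"
proof -
  have "cross_number G g J \<le> (\<Sum>i\<in>J. 1 / w)"
    unfolding cross_number_def using assms by (intro sum_mono divide_left_mono) force+
  then show ?thesis by simp
qed

lemma cross_number_update:
  assumes "finite I" "j \<notin> I"
  shows "cross_number G (g(j := a)) (insert j I) = cross_number G g I + 1 / real (group.ord G a)"
proof -
  have "(\<Sum>i\<in>I. 1 / real (group.ord G ((g(j := a)) i))) = (\<Sum>i\<in>I. 1 / real (group.ord G (g i)))"
    using assms(2) by (intro sum.cong) auto
  then show ?thesis using assms by (simp add: cross_number_def)
qed

section \<open>Replacing a submultiset by its sum\<close>

context comm_group
begin

text \<open>The map \<open>\<rho>\<close> in the proof expands the merged index back into
  \<open>J\<close>. It preserves sums and commutes with intersections, so closure under intersection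
  is inherited. An index from \<open>J\<close> is reused for the sum, so the index type can stay
  fixed.\<close>

lemma ufim_merge:
  assumes "ufim G g I" "J \<subseteq> I" "finprod G g J \<noteq> \<one>" "j \<in> J"
  shows "ufim G (g(j := finprod G g J)) (insert j (I - J))"
proof -
  define g' where "g' = g(j := finprod G g J)"
  define I' where "I' = insert j (I - J)"
  have u: "finite I" "g \<in> I \<rightarrow> carrier G - {\<one>}" "finprod G g I = \<one>" "inter_closed G {\<one>} g I"
    using assms(1) by (auto simp: ufim_iff_inter_closed)
  then have gG: "g \<in> I \<rightarrow> carrier G" by auto
  have sJ: "finprod G g J \<in> carrier G" using finprod_sub_closed[OF gG assms(2)] .
  define \<rho> where "\<rho> = (\<lambda>K. if j \<in> K then (K - {j}) \<union> J else K)"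
  have \<rho>I: "\<rho> K \<subseteq> I" if "K \<subseteq> I'" for K using that assms(2) by (auto simp: \<rho>_def I'_def)
  have \<rho>: "finprod G g' K = finprod G g (\<rho> K)" if K: "K \<subseteq> I'" for K
  proof -
    have sub: "K - {j} \<subseteq> I - J" using K by (auto simp: I'_def)
    then have gK: "g \<in> K - {j} \<rightarrow> carrier G" using gG by auto
    have fin: "finite (K - {j})" using sub u(1) by (meson finite_Diff finite_subset)
    have eq: "finprod G g' (K - {j}) = finprod G g (K - {j})"
      using gK by (intro finprod_cong') (auto simp: g'_def)
    show ?thesis
    proof (cases "j \<in> K")
      case True
      have "finprod G g' (insert j (K - {j})) = g' j \<otimes> finprod G g' (K - {j})"
        using fin gK sJ by (intro finprod_insert) (auto simp: g'_def)
      moreover have "finprod G g ((K - {j}) \<union> J) = finprod G g (K - {j}) \<otimes> finprod G g J"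
        using fin gK sub gG assms(2) u(1)
        by (intro finprod_Un_disjoint) (auto intro: finite_subset)
      ultimately show ?thesis
        using True eq sJ finprod_closed[OF gK] by (simp add: insert_absorb \<rho>_def g'_def m_comm)
    next
      case False
      then show ?thesis using eq by (simp add: \<rho>_def)
    qed
  qed
  have "\<rho> (K \<inter> K') = \<rho> K \<inter> \<rho> K'" if "K \<subseteq> I'" "K' \<subseteq> I'" for K K'
    using that assms(4) by (auto simp: \<rho>_def I'_def)
  then have "inter_closed G {\<one>} g' I'"
    unfolding inter_closed_def
    using inter_closedD[OF u(4) \<rho>I \<rho>I] \<rho> by (metis le_infI1)
  moreover have "finprod G g' I' = \<one>"
  proof -
    have "\<rho> I' = I" using assms(2,4) by (auto simp: \<rho>_def I'_def)
    then show ?thesis using \<rho>[of I'] u(3) by simp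
  qed
  moreover have "g' \<in> I' \<rightarrow> carrier G - {\<one>}"
    using u(2) sJ assms(3) by (auto simp: g'_def I'_def split: if_splits)
  moreover have "finite I'" using u(1) by (simp add: I'_def)
  ultimately show ?thesis unfolding ufim_iff_inter_closed g'_def I'_def by simp
qed

lemma ufim_remove:
  assumes "ufim G g I" "J \<subseteq> I" "finprod G g J = \<one>"
  shows "ufim G g (I - J)"
proof -
  have u: "finite I" "g \<in> I \<rightarrow> carrier G - {\<one>}" "finprod G g I = \<one>" "inter_closed G {\<one>} g I"
    using assms(1) by (auto simp: ufim_iff_inter_closed)
  then have gG: "g \<in> I \<rightarrow> carrier G" by auto
  have "finprod G g (I - J) = \<one>"
    using finprod_Diff_mem[OF triv_subgroup u(1) gG order_refl assms(2)] assms(3) u(3) by simp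
  moreover have "inter_closed G {\<one>} g (I - J)"
    using u(4) unfolding inter_closed_def by (metis Diff_subset subset_trans)
  ultimately show ?thesis using u by (auto simp: ufim_iff_inter_closed)
qed

text \<open>A leftover set can always be cleared away: it is deleted if its sum is trivial and
  merged into one element otherwise. Only the cross number of the rest is kept; the contribution of
  a merged element is given away.\<close>

lemma ufim_absorb:
  fixes g :: "'i \<Rightarrow> 'a"
  assumes "ufim G g I" "J \<subseteq> I"
  obtains g' :: "'i \<Rightarrow> 'a" and I' where "ufim G g' I'" "g' ` I' \<subseteq> insert (finprod G g J) (g ` (I - J))"
    "cross_number G g (I - J) \<le> cross_number G g' I'"
proof (cases "finprod G g J = \<one>")
  case True
  show ?thesis by (rule that[OF ufim_remove[OF assms True]]) auto
next
  case False
  then have "J \<noteq> {}" by auto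
  then obtain j where j: "j \<in> J" by blast
  have "finite (I - J)" using assms(1) by (simp add: ufim_def)
  then have "cross_number G g (I - J) \<le> cross_number G (g(j := finprod G g J)) (insert j (I - J))"
    using cross_number_update[of "I - J" j G g] j by simp
  then show ?thesis by (rule that[OF ufim_merge[OF assms False j], rotated]) auto
qed

end

section \<open>Shortest mergeable subsets\<close>

context coset_labelling
begin

text \<open>A set of least size with nontrivial sum in \<open>N\<close> works. Were it larger than
  \<open>card C\<close>, it would split into two smaller parts with sums in \<open>N\<close>; the
  first sum would be trivial by minimality, and the second part would carry the whole sum. The lower
  bound 2 makes a merge shorten the multiset, the upper bound limits what the merge loses.\<close>

lemma short_nonzero_zero_sum_mod:
  assumes "finite R" "g \<in> R \<rightarrow> M - N" "J\<^sub>0 \<subseteq> R" "finprod G g J\<^sub>0 \<in> N - {\<one>}"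
  obtains J where "J \<subseteq> R" "finprod G g J \<in> N - {\<one>}" "2 \<le> card J" "card J \<le> card C"
proof -
  have gM: "g \<in> R \<rightarrow> M" and gG: "g \<in> R \<rightarrow> carrier G" using assms(2) M_carrier by auto
  define bad where "bad = (\<lambda>J. J \<subseteq> R \<and> finprod G g J \<in> N - {\<one>})"
  define J where "J = arg_min card bad"
  have J: "bad J" and min: "\<And>K. bad K \<Longrightarrow> card J \<le> card K"
    using arg_min_nat_lemma[of bad J\<^sub>0 card] assms(3,4) by (auto simp: J_def bad_def)
  have JR: "J \<subseteq> R" and s: "finprod G g J \<in> N" "finprod G g J \<noteq> \<one>" using J by (auto simp: bad_def)
  have finJ: "finite J" using JR assms(1) by (rule finite_subset)
  have "card J \<le> card C"
  proof (rule ccontr)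
    assume "\<not> card J \<le> card C"
    then obtain K where K: "K \<noteq> {}" "K \<subset> J" "finprod G g K \<in> N"
      using zero_sum_mod_proper_subset[OF finJ, of g] gM JR by auto
    have cK: "card K < card J" using psubset_card_mono[OF finJ K(2)] .
    then have "\<not> bad K" using min by force
    then have K1: "finprod G g K = \<one>" using K JR by (auto simp: bad_def)
    have "finprod G g J = finprod G g K \<otimes> finprod G g (J - K)"
      using finprod_Diff[OF assms(1) gG JR] K(2) by auto
    moreover have "finprod G g (J - K) \<in> carrier G"
      by (rule finprod_sub_closed[OF gG]) (use JR in auto)
    ultimately have "finprod G g (J - K) = finprod G g J" by (simp add: K1)
    then have "bad (J - K)" using s JR by (auto simp: bad_def)
    then have "card J \<le> card (J - K)" by (rule min)
    moreover have "card (J - K) < card J" using K finJ by (intro psubset_card_mono) auto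
    ultimately show False by simp
  qed
  moreover have "2 \<le> card J"
  proof (rule ccontr)
    assume "\<not> 2 \<le> card J"
    moreover have "card J \<noteq> 0" using s finJ by auto
    ultimately have "card J = 1" by simp
    then obtain x where x: "J = {x}" by (auto simp: card_1_singleton_iff)
    then have "g x \<in> M - N" using JR assms(2) by auto
    then show False using s x M_carrier by auto
  qed
  ultimately show ?thesis using JR s that by blast
qed

end

text \<open>For $C_{p^m} \oplus C_q^n$ the subgroup \<open>A\<close> is the $p$-part and \<open>t = q\<close>; for $p$-groups \<open>A\<close> is the
  whole group and \<open>t = 1\<close>.\<close>

locale descent_step = coset_labelling +
  fixes A :: "'a set" and s t :: real
  assumes finite_G: "finite (carrier G)" and A: "subgroup A G" and s: "s > 0" and t: "t \<ge> 1"
    and ord_A: "\<And>x. x \<in> M - N \<Longrightarrow> x \<in> A \<Longrightarrow> real (card C) * s \<le> real (ord x)"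
    and ord_M: "\<And>x. x \<in> M - N \<Longrightarrow> x \<notin> A \<Longrightarrow> real (card C) * (s * t) \<le> real (ord x)"
    and ord_N_A: "\<And>x. x \<in> N \<Longrightarrow> x \<in> A \<Longrightarrow> real (ord x) \<le> s"
    and ord_N: "\<And>x. x \<in> N \<Longrightarrow> real (ord x) \<le> s * t"
begin

lemma card_C_pos: "0 < card C"
proof -
  have "c \<one> \<in> C" using c_mem subgroup.one_closed[OF M] by auto
  then show ?thesis using finite_C card_gt_0_iff by blast
qed

lemma inverse_ord_ge:
  assumes "x \<in> N" "real (ord x) \<le> w"
  shows "1 / w \<le> 1 / real (ord x)"
proof -
  have "ord x \<ge> 1" using assms(1) N_carrier by (intro ord_ge_1[OF finite_G]) auto
  then show ?thesis using assms(2) by (intro divide_left_mono) auto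
qed

text \<open>The number of elements and the factor \<open>card C\<close> in their orders cancel, so
  the loss does not depend on the index.\<close>

lemma cross_number_le_inverse:
  assumes "w > 0" "card J \<le> card C" "\<And>i. i \<in> J \<Longrightarrow> real (card C) * w \<le> real (ord (g i))"
  shows "cross_number G g J \<le> 1 / w"
proof -
  have "cross_number G g J \<le> real (card J) / (real (card C) * w)"
    using assms card_C_pos by (intro cross_number_le) auto
  also have "\<dots> \<le> real (card C) / (real (card C) * w)"
    using assms by (intro divide_right_mono) auto
  also have "\<dots> = 1 / w" using card_C_pos by simp
  finally show ?thesis .
qed

text \<open>Let the elements outside \<^term>\<open>N\<close> split into those inside and outside \<^term>\<open>A\<close>. As long as one
  of the two parts has a subset with nontrivial sum in \<^term>\<open>N\<close>, a shortest such subset can be merged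
  without lowering the cross number. Afterwards each part has at most \<^term>\<open>card C\<close> elements, and one
  final merge into \<^term>\<open>N\<close>, or the lack of any candidate for it, brings the total loss below
  \<^term>\<open>1 / s\<close>.\<close>

lemma ufim_descent:
  fixes g :: "'i \<Rightarrow> 'a"
  assumes "ufim G g I" "g \<in> I \<rightarrow> M"
  obtains g' :: "'i \<Rightarrow> 'a" and I' where "ufim G g' I'" "g' \<in> I' \<rightarrow> N"
    "cross_number G g I \<le> cross_number G g' I' + 1 / s"
proof -
  have "\<exists>(g' :: 'i \<Rightarrow> 'a) I'. ufim G g' I' \<and> g' \<in> I' \<rightarrow> N \<and> cross_number G g I \<le> cross_number G g' I' + 1 / s"
    using assms
  proof (induction "card I" arbitrary: g I rule: less_induct)
    case less
    have u: "finite I" "finprod G g I = \<one>" "inter_closed G {\<one>} g I"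
      using less.prems(1) by (auto simp: ufim_iff_inter_closed)
    have gM: "g \<in> I \<rightarrow> M" by fact
    have gG: "g \<in> I \<rightarrow> carrier G" using gM M_carrier by auto
    have N1: "\<one> \<in> N" by (rule subgroup.one_closed[OF N])
    have st: "s * t > 0" using s t by simp
    define P where "P = {i \<in> I. g i \<notin> N \<and> g i \<in> A}"
    define T where "T = {i \<in> I. g i \<notin> N \<and> g i \<notin> A}"
    define L where "L = {i \<in> I. g i \<notin> N}"
    have sub: "P \<subseteq> I" "T \<subseteq> I" "L \<subseteq> I" and L: "L = P \<union> T" "P \<inter> T = {}"
      by (auto simp: P_def T_def L_def)
    have gMN: "g \<in> P \<rightarrow> M - N" "g \<in> T \<rightarrow> M - N" "g \<in> L \<rightarrow> M - N"
      using gM by (auto simp: P_def T_def L_def)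
    \<comment> \<open>The merged elements contribute at most 1/w and their sum has order at most
      \<open>w\<close>, so the cross number does not drop; at least two elements become one, so the
      induction hypothesis applies.\<close>
    have merge: ?case
      if R: "R \<subseteq> I" "g \<in> R \<rightarrow> M - N" and w: "w > 0" "\<And>i. i \<in> R \<Longrightarrow> real (card C) * w \<le> real (ord (g i))"
        "\<And>J. J \<subseteq> R \<Longrightarrow> finprod G g J \<in> N \<Longrightarrow> real (ord (finprod G g J)) \<le> w"
        and bad: "J\<^sub>0 \<subseteq> R" "finprod G g J\<^sub>0 \<in> N" "finprod G g J\<^sub>0 \<noteq> \<one>" for R J\<^sub>0 w
    proof -
      obtain J where J: "J \<subseteq> R" "finprod G g J \<in> N - {\<one>}" "2 \<le> card J" "card J \<le> card C"
        using short_nonzero_zero_sum_mod[OF finite_subset[OF R(1) u(1)] R(2) bad(1)] bad by blast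
      have JI: "J \<subseteq> I" using J R by auto
      have "J \<noteq> {}" using J(3) by auto
      then obtain j where j: "j \<in> J" by blast
      define g1 where "g1 = g(j := finprod G g J)"
      define I1 where "I1 = insert j (I - J)"
      have u1: "ufim G g1 I1" unfolding g1_def I1_def using ufim_merge[OF less.prems(1) JI _ j] J(2) by simp
      have "cross_number G g J \<le> 1 / w" using J w by (intro cross_number_le_inverse) auto
      also have "\<dots> \<le> 1 / real (ord (finprod G g J))" using J w(3) by (intro inverse_ord_ge) auto
      finally have cr: "cross_number G g I \<le> cross_number G g1 I1"
        using cross_number_Diff[OF u(1) JI, of G g] cross_number_update[of "I - J" j G g] u(1) j
        by (simp add: g1_def I1_def)
      have less_card: "card I1 < card I"
      proof -
        have "card I1 = Suc (card (I - J))" unfolding I1_def using u(1) j by simp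
        moreover have "card (I - J) = card I - card J" using JI u(1) by (simp add: card_Diff_subset finite_subset)
        moreover have "card J \<le> card I" using JI u(1) by (rule card_mono[rotated])
        ultimately show ?thesis using J(3) by linarith
      qed
      have "g1 \<in> I1 \<rightarrow> M" using gM J(2) N_sub_M by (auto simp: g1_def I1_def)
      from less.hyps[OF less_card u1 this] obtain g' :: "'i \<Rightarrow> 'a" and I' where
        "ufim G g' I'" "g' \<in> I' \<rightarrow> N" "cross_number G g1 I1 \<le> cross_number G g' I' + 1 / s"
        by (elim exE conjE)
      then show ?thesis using cr by (intro exI[of _ g'] exI[of _ I']) auto
    qed
    \<comment> \<open>If all sums over subsets of \<open>R\<close> that lie in \<open>N\<close> are
      trivial, closure modulo \<open>N\<close> follows from the closure known for the trivial
      subgroup, and the size bound relative to \<open>N\<close> becomes available.\<close>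
    have card_le: "card R \<le> card C"
      if R: "R \<subseteq> I" "g \<in> R \<rightarrow> M - N"
        and none: "\<And>J. J \<subseteq> R \<Longrightarrow> finprod G g J \<in> N \<Longrightarrow> finprod G g J = \<one>" for R
    proof (rule card_le_index[OF u(1) gM _ R])
      have "finprod G g (J \<inter> K) \<in> N"
        if JK: "J \<subseteq> R" "K \<subseteq> R" "finprod G g J \<in> N" "finprod G g K \<in> N" for J K
      proof -
        have "finprod G g (J \<inter> K) \<in> {\<one>}"
          using none[OF JK(1,3)] none[OF JK(2,4)] JK(1,2) R(1)
          by (intro inter_closedD[OF u(3)]) auto
        then show ?thesis using N1 by simp
      qed
      then show "inter_closed G N g R" by (simp add: inter_closed_def)
    qed (use u N1 in simp)
    have ordP: "real (card C) * s \<le> real (ord (g i))" if "i \<in> P" for i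
      using that gM by (intro ord_A) (auto simp: P_def)
    have ordT: "real (card C) * (s * t) \<le> real (ord (g i))" if "i \<in> T" for i
      using that gM by (intro ord_M) (auto simp: T_def)
    have ord_NP: "real (ord (finprod G g J)) \<le> s" if "J \<subseteq> P" "finprod G g J \<in> N" for J
      using that(1) by (intro ord_N_A[OF that(2)] finprod_mem[OF A]) (auto simp: P_def)
    show ?case
    proof (cases "\<exists>J. (J \<subseteq> P \<or> J \<subseteq> T) \<and> finprod G g J \<in> N \<and> finprod G g J \<noteq> \<one>")
      case True
      then obtain J where J: "J \<subseteq> P \<or> J \<subseteq> T" "finprod G g J \<in> N" "finprod G g J \<noteq> \<one>" by blast
      from J(1) show ?thesis
      proof
        assume "J \<subseteq> P"
        show ?thesis by (rule merge[OF sub(1) gMN(1) s ordP ord_NP \<open>J \<subseteq> P\<close> J(2,3)])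
      next
        assume "J \<subseteq> T"
        show ?thesis by (rule merge[OF sub(2) gMN(2) st ordT ord_N \<open>J \<subseteq> T\<close> J(2,3)])
      qed
    next
      case False
      then have "card P \<le> card C" "card T \<le> card C"
        using card_le[OF sub(1) gMN(1)] card_le[OF sub(2) gMN(2)] by blast+
      then have crPT: "cross_number G g P \<le> 1 / s" "cross_number G g T \<le> 1 / (s * t)"
        using cross_number_le_inverse[OF s, of P g] cross_number_le_inverse[OF st, of T g] ordP ordT by auto
      have crI: "cross_number G g I = cross_number G g (I - L) + cross_number G g L"
        by (rule cross_number_Diff[OF u(1) sub(3)])
      have gNL: "g \<in> I - L \<rightarrow> N" by (auto simp: L_def)
      have LN: "finprod G g L \<in> N"
      proof -
        have "finprod G g (I - L) \<in> N" using finprod_mem[OF N gNL] .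
        moreover have "I - (I - L) = L" using sub(3) by auto
        ultimately show ?thesis
          using finprod_Diff_mem[OF N u(1) gG order_refl, of "I - L"] u(2) N1 by simp
      qed
      show ?thesis
      proof (cases "\<exists>J\<subseteq>L. finprod G g J \<in> N \<and> finprod G g J \<noteq> \<one>")
        case True
        \<comment> \<open>This \<open>J\<close> meets both \<open>P\<close> and \<open>T\<close>.
          Clearing all of \<open>L\<close> costs at most 1/s + 1/(s t), and the sum of
          \<open>J\<close>, kept as an element of \<open>N\<close>, gives back at least 1/(s
          t).\<close>
        then obtain J where J: "J \<subseteq> L" "finprod G g J \<in> N" "finprod G g J \<noteq> \<one>" by blast
        then have "J \<noteq> {}" by auto
        then obtain j where j: "j \<in> J" by blast
        have JI: "J \<subseteq> I" using J sub by auto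
        define g1 where "g1 = g(j := finprod G g J)"
        define I1 where "I1 = insert j (I - J)"
        have u1: "ufim G g1 I1" unfolding g1_def I1_def using ufim_merge[OF less.prems(1) JI J(3) j] .
        have LJ: "L - J \<subseteq> I1" using sub by (auto simp: I1_def)
        obtain g' :: "'i \<Rightarrow> 'a" and I' where g': "ufim G g' I'" "g' ` I' \<subseteq> insert (finprod G g1 (L - J)) (g1 ` (I1 - (L - J)))"
          "cross_number G g1 (I1 - (L - J)) \<le> cross_number G g' I'"
          by (rule ufim_absorb[OF u1 LJ])
        have I1: "I1 - (L - J) = insert j (I - L)" using J(1) j by (auto simp: I1_def)
        have "finprod G g1 (L - J) = finprod G g (L - J)"
          using gG sub j by (intro finprod_cong') (auto simp: g1_def)
        also have "\<dots> \<in> N"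
          using finprod_Diff_mem[OF N u(1) gG sub(3) J(1,2)] LN by simp
        finally have "finprod G g1 (L - J) \<in> N" .
        moreover have "g1 ` (I1 - (L - J)) \<subseteq> N" unfolding I1 using gNL J(2) by (auto simp: g1_def)
        ultimately have "g' ` I' \<subseteq> N" using g'(2) by (meson insert_subset subset_trans)
        then have g'N: "g' \<in> I' \<rightarrow> N" by auto
        have "1 / (s * t) \<le> 1 / real (ord (finprod G g J))" using J(2) ord_N by (intro inverse_ord_ge) auto
        also have "cross_number G g (I - L) + \<dots> = cross_number G g1 (insert j (I - L))"
          using cross_number_update[of "I - L" j G g] u(1) J(1) j by (auto simp: g1_def)
        finally have "cross_number G g (I - L) + 1 / (s * t) \<le> cross_number G g' I'"
          using g'(3) unfolding I1 by linarith
        moreover have "cross_number G g L = cross_number G g P + cross_number G g T"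
          unfolding cross_number_def L(1)
          using L(2) sub u(1) by (intro sum.union_disjoint) (auto intro: finite_subset)
        ultimately show ?thesis
          using g' g'N crPT crI by (intro exI[of _ g'] exI[of _ I'] conjI) linarith+
      next
        case False
        \<comment> \<open>Without any nontrivial sum in \<open>N\<close> the size bound holds for
          \<open>L\<close> as a whole, and by t \<ge> 1 all its orders are at least
          \<open>card C * s\<close>. So \<open>L\<close> is deleted at the price of 1/s.\<close>
        have "finprod G g L = \<one>" using False LN by blast
        then have "ufim G g (I - L)" by (rule ufim_remove[OF less.prems(1) sub(3)])
        moreover have "card L \<le> card C" using card_le[OF sub(3) gMN(3)] False by blast
        then have "cross_number G g L \<le> 1 / s"
        proof (rule cross_number_le_inverse[OF s])
          fix i assume "i \<in> L"
          have "real (card C) * s \<le> real (card C) * (s * t)"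
            using s t by (intro mult_left_mono) auto
          then show "real (card C) * s \<le> real (ord (g i))"
            using \<open>i \<in> L\<close> ordP[of i] ordT[of i] L by force
        qed
        ultimately show ?thesis
          using gNL crI by (intro exI[of _ g] exI[of _ "I - L"] conjI) linarith+
      qed
    qed
  qed
  then show ?thesis using that by blast
qed

end

section \<open>Transfer and a lower bound for cyclic groups\<close>

text \<open>An injective homomorphism on a subgroup containing all the elements respects triviality
  of sums and keeps orders, so the criterion and the cross number carry over. The bijection
  \<open>e\<close> is there because \<open>K1\<close> admits only index sets \<open>{1..l}\<close>,
  while merging leaves arbitrary finite ones.\<close>

lemma ufim_transfer:
  assumes G: "comm_group G" and H: "comm_group H" and u: "ufim G g I"
    and N: "subgroup N G" "g \<in> I \<rightarrow> N" and e: "bij_betw e I' I"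
    and \<phi>: "inj_on \<phi> N" "\<And>x. x \<in> N \<Longrightarrow> \<phi> x \<in> carrier H"
      "\<And>x y. x \<in> N \<Longrightarrow> y \<in> N \<Longrightarrow> \<phi> (x \<otimes>\<^bsub>G\<^esub> y) = \<phi> x \<otimes>\<^bsub>H\<^esub> \<phi> y"
  shows "ufim H (\<lambda>i. \<phi> (g (e i))) I'"
    and "cross_number H (\<lambda>i. \<phi> (g (e i))) I' = cross_number G g I"
proof -
  interpret G: comm_group G by fact
  interpret H: comm_group H by fact
  have NG: "N \<subseteq> carrier G" using N(1) by (rule subgroup.subset)
  have N1: "\<one>\<^bsub>G\<^esub> \<in> N" by (rule subgroup.one_closed[OF N(1)])
  have one: "\<phi> \<one>\<^bsub>G\<^esub> = \<one>\<^bsub>H\<^esub>"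
    using \<phi>(3)[OF N1 N1] \<phi>(2)[OF N1] by simp
  have one_iff: "\<phi> x = \<one>\<^bsub>H\<^esub> \<longleftrightarrow> x = \<one>\<^bsub>G\<^esub>" if "x \<in> N" for x
    using inj_onD[OF \<phi>(1) _ that N1] one by auto
  have uf: "finite I" "g \<in> I \<rightarrow> carrier G - {\<one>\<^bsub>G\<^esub>}" "finprod G g I = \<one>\<^bsub>G\<^esub>"
    "inter_closed G {\<one>\<^bsub>G\<^esub>} g I"
    using u by (auto simp: G.ufim_iff_inter_closed)
  have eI: "e ` I' = I" "inj_on e I'" using e by (auto simp: bij_betw_def)
  have finI': "finite I'" using bij_betw_finite[OF e] uf(1) by simp
  have ge: "g (e i) \<in> N" if "i \<in> I'" for i using N(2) eI(1) that by auto
  have sN: "finprod G g (e ` J) \<in> N" if "J \<subseteq> I'" for J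
    using that ge by (intro G.finprod_mem[OF N(1)]) auto
  have fp: "finprod H (\<lambda>i. \<phi> (g (e i))) J = \<phi> (finprod G g (e ` J))" if "J \<subseteq> I'" for J
    using finite_subset[OF that finI'] that
  proof (induction J rule: finite_induct)
    case (insert x F)
    have x: "x \<in> I'" and F: "F \<subseteq> I'" using insert.prems by auto
    have "e x \<notin> e ` F" using x F insert.hyps(2) eI(2) by (auto simp: inj_on_def)
    then have "finprod G g (insert (e x) (e ` F)) = g (e x) \<otimes>\<^bsub>G\<^esub> finprod G g (e ` F)"
      using insert.hyps(1) ge[OF x] ge F NG by (intro G.finprod_insert) auto
    moreover have "finprod H (\<lambda>i. \<phi> (g (e i))) (insert x F)
      = \<phi> (g (e x)) \<otimes>\<^bsub>H\<^esub> finprod H (\<lambda>i. \<phi> (g (e i))) F"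
      using insert.hyps ge[OF x] ge F \<phi>(2) by (intro H.finprod_insert) auto
    ultimately show ?case using insert.IH[OF F] \<phi>(3)[OF ge[OF x] sN[OF F]] by simp
  qed (simp add: one)
  have zs: "finprod H (\<lambda>i. \<phi> (g (e i))) J = \<one>\<^bsub>H\<^esub> \<longleftrightarrow> finprod G g (e ` J) = \<one>\<^bsub>G\<^esub>" if "J \<subseteq> I'" for J
    using fp[OF that] one_iff[OF sN[OF that]] by simp
  have "inter_closed H {\<one>\<^bsub>H\<^esub>} (\<lambda>i. \<phi> (g (e i))) I'"
    unfolding inter_closed_def
  proof (intro allI impI)
    fix J K assume *: "J \<subseteq> I' \<and> K \<subseteq> I' \<and> finprod H (\<lambda>i. \<phi> (g (e i))) J \<in> {\<one>\<^bsub>H\<^esub>} \<and>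
      finprod H (\<lambda>i. \<phi> (g (e i))) K \<in> {\<one>\<^bsub>H\<^esub>}"
    then have "finprod G g (e ` J \<inter> e ` K) \<in> {\<one>\<^bsub>G\<^esub>}"
      using zs eI(1) by (intro inter_closedD[OF uf(4)]) auto
    moreover have "e ` (J \<inter> K) = e ` J \<inter> e ` K"
      using * by (intro inj_on_image_Int[OF eI(2)]) auto
    ultimately show "finprod H (\<lambda>i. \<phi> (g (e i))) (J \<inter> K) \<in> {\<one>\<^bsub>H\<^esub>}"
      using zs[of "J \<inter> K"] * by auto
  qed
  moreover have "(\<lambda>i. \<phi> (g (e i))) \<in> I' \<rightarrow> carrier H - {\<one>\<^bsub>H\<^esub>}"
    using ge \<phi>(2) one_iff uf(2) eI(1) by auto
  moreover have "finprod H (\<lambda>i. \<phi> (g (e i))) I' = \<one>\<^bsub>H\<^esub>" using zs[of I'] eI uf(3) by simp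
  ultimately show "ufim H (\<lambda>i. \<phi> (g (e i))) I'"
    using finI' by (simp add: H.ufim_iff_inter_closed)
  have pow: "\<phi> (x [^]\<^bsub>G\<^esub> k) = \<phi> x [^]\<^bsub>H\<^esub> k \<and> x [^]\<^bsub>G\<^esub> k \<in> N" if x: "x \<in> N" for x and k :: nat
    by (induction k) (auto simp: one N1 x \<phi>(3) subgroup.m_closed[OF N(1)])
  have ord: "H.ord (\<phi> x) = G.ord x" if x: "x \<in> N" for x
  proof -
    have "\<phi> x [^]\<^bsub>H\<^esub> k = \<one>\<^bsub>H\<^esub> \<longleftrightarrow> G.ord x dvd k" for k :: nat
      using pow[OF x, of k] one_iff[of "x [^]\<^bsub>G\<^esub> k"] G.pow_eq_id[of x k] x NG by auto
    then show ?thesis using H.ord_unique[OF \<phi>(2)[OF x]] by blast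
  qed
  show "cross_number H (\<lambda>i. \<phi> (g (e i))) I' = cross_number G g I"
    unfolding cross_number_def
    using sum.reindex_bij_betw[OF e, of "\<lambda>i. 1 / real (G.ord (g i))"] ord ge by simp
qed

lemma cross_number_le_K1:
  assumes G: "comm_group G" and H: "comm_group H" "finite (carrier H)" and u: "ufim G g I"
    and N: "subgroup N G" "g \<in> I \<rightarrow> N"
    and \<phi>: "inj_on \<phi> N" "\<And>x. x \<in> N \<Longrightarrow> \<phi> x \<in> carrier H"
      "\<And>x y. x \<in> N \<Longrightarrow> y \<in> N \<Longrightarrow> \<phi> (x \<otimes>\<^bsub>G\<^esub> y) = \<phi> x \<otimes>\<^bsub>H\<^esub> \<phi> y"
  shows "cross_number G g I \<le> K1 H"
proof -
  have "finite I" using u by (simp add: ufim_def)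
  then obtain e where e: "bij_betw e {1..card I} I" using ex_bij_betw_nat_finite_1 by blast
  note t = ufim_transfer[where \<phi> = \<phi>, OF G H(1) u N e \<phi>]
  have "cross_number H (\<lambda>i. \<phi> (g (e i))) {1..card I} \<le> K1 H"
    unfolding K1_def using t(1) by (intro Max_ge K1_well_defined[OF H]) auto
  then show ?thesis using t(2) by simp
qed

lemma K1_leI:
  fixes G :: "('a, 'b) monoid_scheme"
  assumes "comm_group G" "finite (carrier G)"
    and "\<And>(g :: nat \<Rightarrow> 'a) l. ufim G g {1..l} \<Longrightarrow> cross_number G g {1..l} \<le> b"
  shows "K1 G \<le> b"
  unfolding K1_def using assms(3) K1_well_defined[OF assms(1,2)] by (subst Max_le_iff) auto

text \<open>Downward induction from k = m. Modulo p^(m-k+1) the terms with j < k vanish through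
  their power of p and those with j > k by induction, so p divides \<open>r k\<close>. In place of
  digits, the \<open>r k\<close> are integers that vanish as soon as p divides them.\<close>

lemma dvd_digit_sum_imp_zero:
  fixes p :: int and r :: "nat \<Rightarrow> int"
  assumes p: "p \<noteq> 0" and dvd: "p ^ m dvd (\<Sum>k=1..m. p ^ (m - k) * r k)"
    and r: "\<And>k. k \<in> {1..m} \<Longrightarrow> p dvd r k \<Longrightarrow> r k = 0" and k: "k \<in> {1..m}"
  shows "r k = 0"
  using k
proof (induction "m - k" arbitrary: k rule: less_induct)
  case less
  have sk: "Suc (m - k) \<le> m" using less.prems by auto
  have "(\<Sum>j=1..m. p ^ (m - j) * r j)
    = p ^ (m - k) * r k + (\<Sum>j\<in>{1..m} - {k}. p ^ (m - j) * r j)"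
    using less.prems by (intro sum.remove) auto
  moreover have "p ^ Suc (m - k) dvd (\<Sum>j\<in>{1..m} - {k}. p ^ (m - j) * r j)"
  proof (rule dvd_sum)
    fix j assume j: "j \<in> {1..m} - {k}"
    show "p ^ Suc (m - k) dvd p ^ (m - j) * r j"
    proof (cases "j < k")
      case True
      then show ?thesis using less.prems j by (intro dvd_mult2 le_imp_power_dvd) auto
    next
      case False
      then have "r j = 0" using j less.prems by (intro less.hyps) auto
      then show ?thesis by simp
    qed
  qed
  moreover have "p ^ Suc (m - k) dvd (\<Sum>j=1..m. p ^ (m - j) * r j)"
    using le_imp_power_dvd[OF sk] dvd by (rule dvd_trans)
  ultimately have "p ^ Suc (m - k) dvd p ^ (m - k) * r k"
    by (simp add: dvd_add_left_iff)
  then have "p ^ (m - k) * p dvd p ^ (m - k) * r k" by (simp add: mult.commute)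
  then have "p dvd r k" using p by simp
  then show ?case using r less.prems by blast
qed

text \<open>The witness has, for each \<^term>\<open>k \<in> {1..m}\<close>, a block of \<^term>\<open>p\<close> elements of order
  \<^term>\<open>p ^ k\<close>: the element \<^term>\<open>p ^ (m - k)\<close> taken \<^term>\<open>p - 1\<close> times, and the negative of their
  sum.\<close>

lemma K1_integer_mod_group_ge:
  fixes p m :: nat
  assumes p: "Factorial_Ring.prime p"
  shows "(\<Sum>k<m. 1 / real p ^ k) \<le> K1 (integer_mod_group (p ^ m))"
proof -
  define G where "G = integer_mod_group (p ^ m)"
  interpret comm_group G unfolding G_def by simp
  have p0: "p > 0" "p > 1" using prime_gt_0_nat[OF p] prime_gt_1_nat[OF p] by simp_all
  have carrier_G: "carrier G = {0..<int p ^ m}"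
    using p0 by (simp add: G_def carrier_integer_mod_group)
  have one_G: "\<one>\<^bsub>G\<^esub> = 0" by (simp add: G_def)
  have mod_G: "x mod int p ^ m \<in> carrier G" for x using p0 by (simp add: carrier_G)
  \<comment> \<open>There are p - 1 ones and one entry -(p - 1), so a full row sums to 0. Every
    entry is 1 modulo p, so modulo p a partial row sum counts its elements.\<close>
  define v where "v = (\<lambda>i::nat. if i = 0 then 1 - int p else 1)"
  define w where "w = (\<lambda>(k, i). int p ^ (m - k) * v i)"
  define g where "g = (\<lambda>x. w x mod int p ^ m)"
  define I where "I = {1..m} \<times> {..<p}"
  have finI: "finite I" by (simp add: I_def)
  have fp: "finprod G g J = (\<Sum>x\<in>J. w x) mod int p ^ m" if "finite J" for J
    using that
  proof (induction J rule: finite_induct)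
    case (insert x F)
    have "finprod G g (insert x F) = g x \<otimes>\<^bsub>G\<^esub> finprod G g F"
      using insert.hyps mod_G by (intro finprod_insert) (auto simp: g_def)
    then show ?case using insert by (simp add: G_def g_def mod_simps)
  qed (simp add: one_G)
  have vdvd: "\<not> int p dvd v i" for i
  proof
    assume "int p dvd v i"
    then have "int p dvd 1" by (auto simp: v_def dvd_diff_left_iff split: if_splits)
    then show False using p0 by simp
  qed
  define r where "r = (\<lambda>(J :: (nat \<times> nat) set) k. \<Sum>i\<in>{i. (k, i) \<in> J}. v i)"
  have sum_w: "(\<Sum>x\<in>J. w x) = (\<Sum>k=1..m. int p ^ (m - k) * r J k)" if J: "J \<subseteq> I" for J
  proof -
    have "J = (SIGMA k:{1..m}. {i. (k, i) \<in> J})" using J by (auto simp: I_def)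
    moreover have "finite {i. (k, i) \<in> J}" for k
      by (rule finite_subset[of _ "{..<p}"]) (use J in \<open>auto simp: I_def\<close>)
    ultimately have "(\<Sum>x\<in>J. w x) = (\<Sum>k=1..m. \<Sum>i\<in>{i. (k, i) \<in> J}. w (k, i))"
      using sum.Sigma[of "{1..m}" "\<lambda>k. {i. (k, i) \<in> J}" "\<lambda>k i. w (k, i)"] by simp
    then show ?thesis by (simp add: w_def r_def sum_distrib_left)
  qed
  \<comment> \<open>A row has p elements, so a count divisible by p is 0 or p.\<close>
  have row: "{i. (k, i) \<in> J} = {} \<or> {i. (k, i) \<in> J} = {..<p}" if J: "J \<subseteq> I" and d: "int p dvd r J k" for J k
  proof -
    define R where "R = {i. (k, i) \<in> J}"
    have R: "R \<subseteq> {..<p}" using J by (auto simp: R_def I_def)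
    then have finR: "finite R" by (rule finite_subset) simp
    have "r J k = (\<Sum>i\<in>R. 1 - (if i = 0 then int p else 0))"
      unfolding r_def R_def v_def by (intro sum.cong) auto
    also have "\<dots> = int (card R) - (\<Sum>i\<in>R. if i = 0 then int p else 0)"
      by (simp add: sum_subtractf)
    finally have "int (card R) = r J k + (\<Sum>i\<in>R. if i = 0 then int p else 0)" by simp
    moreover have "int p dvd (\<Sum>i\<in>R. if i = 0 then int p else 0)" by (intro dvd_sum) auto
    ultimately have "int p dvd int (card R)" using d by simp
    then have pd: "p dvd card R" by simp
    show ?thesis
    proof (cases "card R = 0")
      case False
      then have "p \<le> card R" using pd by (intro dvd_imp_le) auto
      then have "R = {..<p}" using R by (intro card_seteq) auto
      then show ?thesis by (simp add: R_def)
    qed (use finR in \<open>simp add: R_def\<close>)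
  qed
  have r0: "r J k = 0" if "{i. (k, i) \<in> J} = {} \<or> {i. (k, i) \<in> J} = {..<p}" for J k
  proof -
    have "(\<Sum>i<p. v i) = v 0 + (\<Sum>i\<in>{..<p} - {0}. v i)"
      using p0 by (intro sum.remove) auto
    also have "(\<Sum>i\<in>{..<p} - {0}. v i) = (\<Sum>i\<in>{..<p} - {0}. 1)"
      by (intro sum.cong) (auto simp: v_def)
    also have "\<dots> = int p - 1" using p0 by simp
    finally have "(\<Sum>i<p. v i) = 0" by (simp add: v_def)
    then show ?thesis unfolding r_def using that by (elim disjE) simp_all
  qed
  \<comment> \<open>The zero-sum subsets are thus the unions of full rows, a family closed under
    intersection.\<close>
  have zs: "finprod G g J = 0 \<longleftrightarrow>
      (\<forall>k\<in>{1..m}. {i. (k, i) \<in> J} = {} \<or> {i. (k, i) \<in> J} = {..<p})" if J: "J \<subseteq> I" for J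
  proof
    assume "finprod G g J = 0"
    then have d: "int p ^ m dvd (\<Sum>k=1..m. int p ^ (m - k) * r J k)"
      using fp[OF finite_subset[OF J finI]] sum_w[OF J] by (simp add: dvd_eq_mod_eq_0)
    have "r J k = 0" if k: "k \<in> {1..m}" for k
    proof (rule dvd_digit_sum_imp_zero[OF _ d _ k])
      show "r J k' = 0" if "int p dvd r J k'" for k' using row[OF J that] by (rule r0)
    qed (use p0 in simp)
    then have rdvd: "int p dvd r J k" if "k \<in> {1..m}" for k using that by simp
    show "\<forall>k\<in>{1..m}. {i. (k, i) \<in> J} = {} \<or> {i. (k, i) \<in> J} = {..<p}"
      by (intro ballI row[OF J] rdvd)
  next
    assume "\<forall>k\<in>{1..m}. {i. (k, i) \<in> J} = {} \<or> {i. (k, i) \<in> J} = {..<p}"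
    then have "r J k = 0" if "k \<in> {1..m}" for k using that by (intro r0) (rule bspec)
    then have "(\<Sum>k=1..m. int p ^ (m - k) * r J k) = 0" by (intro sum.neutral) simp
    then show "finprod G g J = 0"
      using fp[OF finite_subset[OF J finI]] sum_w[OF J] by simp
  qed
  have "inter_closed G {\<one>\<^bsub>G\<^esub>} g I"
    unfolding inter_closed_def one_G
  proof (intro allI impI)
    fix J K assume *: "J \<subseteq> I \<and> K \<subseteq> I \<and> finprod G g J \<in> {0} \<and> finprod G g K \<in> {0}"
    have "{i. (k, i) \<in> J \<inter> K} = {i. (k, i) \<in> J} \<inter> {i. (k, i) \<in> K}" for k by auto
    moreover have "\<forall>k\<in>{1..m}. {i. (k, i) \<in> J} = {} \<or> {i. (k, i) \<in> J} = {..<p}"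
      "\<forall>k\<in>{1..m}. {i. (k, i) \<in> K} = {} \<or> {i. (k, i) \<in> K} = {..<p}"
      using * zs by auto
    ultimately have "\<forall>k\<in>{1..m}. {i. (k, i) \<in> J \<inter> K} = {} \<or> {i. (k, i) \<in> J \<inter> K} = {..<p}"
      by (metis Int_absorb Int_empty_left Int_empty_right)
    moreover have "J \<inter> K \<subseteq> I" using * by auto
    ultimately show "finprod G g (J \<inter> K) \<in> {0}" using zs by simp
  qed
  moreover have "finprod G g I = 0"
    using zs[of I] by (auto simp: I_def)
  moreover have "g x \<noteq> 0" if xI: "x \<in> I" for x
  proof
    assume g0: "g x = 0"
    obtain k i where x: "x = (k, i)" "1 \<le> k" "k \<le> m" using xI by (auto simp: I_def)
    have "int p ^ m dvd int p ^ (m - k) * v i" using g0 x by (simp add: g_def w_def dvd_eq_mod_eq_0)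
    moreover have "int p ^ m = int p ^ (m - k) * int p ^ k" using x by (simp flip: power_add)
    ultimately have "int p ^ k dvd v i" using p0 by simp
    moreover have "int p dvd int p ^ k" using x by (intro dvd_power) auto
    ultimately show False using vdvd dvd_trans by blast
  qed
  ultimately have u: "ufim G g I"
    using finI mod_G by (auto simp: ufim_iff_inter_closed one_G g_def)
  \<comment> \<open>Row \<open>k\<close> contributes at least p times 1/p^k, which is the summand
    with exponent k - 1.\<close>
  have "(\<Sum>k<m. 1 / real p ^ k) = (\<Sum>k=1..m. 1 / real p ^ (k - 1))"
    by (rule sum.reindex_bij_witness[of _ "\<lambda>k. k - 1" Suc]) auto
  also have "\<dots> = (\<Sum>k=1..m. \<Sum>i<p. 1 / real p ^ k)"
  proof (rule sum.cong)
    fix k assume "k \<in> {1..m}"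
    then obtain k' where "k = Suc k'" by (cases k) auto
    then show "1 / real p ^ (k - 1) = (\<Sum>i<p. 1 / real p ^ k)" using p0 by simp
  qed simp
  also have "\<dots> = (\<Sum>(k, i)\<in>I. 1 / real p ^ k)" unfolding I_def by (rule sum.cartesian_product)
  also have "\<dots> \<le> cross_number G g I"
    unfolding cross_number_def
  proof (rule sum_mono)
    fix x assume "x \<in> I"
    then obtain k i where x: "x = (k, i)" "1 \<le> k" "k \<le> m" by (auto simp: I_def)
    have gx: "g x \<in> carrier G" using mod_G by (simp add: g_def)
    have "g x [^]\<^bsub>G\<^esub> (p ^ k) = int p ^ k * (int p ^ (m - k) * v i) mod int p ^ m"
      using x by (simp add: G_def g_def w_def mod_simps)
    also have "int p ^ k * (int p ^ (m - k) * v i) = int p ^ m * v i"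
      using x by (simp add: mult.assoc[symmetric] flip: power_add)
    finally have "g x [^]\<^bsub>G\<^esub> (p ^ k) = \<one>\<^bsub>G\<^esub>" by (simp add: one_G)
    then have "ord (g x) dvd p ^ k" using pow_eq_id[OF gx] by simp
    then have "ord (g x) \<le> p ^ k" "ord (g x) > 0"
      using p0 dvd_imp_le[of "ord (g x)" "p ^ k"] by (auto intro: Nat.gr0I)
    then have "1 / real (p ^ k) \<le> 1 / real (ord (g x))" using p0 by (intro divide_left_mono mult_pos_pos) auto
    then show "(case x of (k, i) \<Rightarrow> 1 / real p ^ k) \<le> 1 / real (ord (g x))" using x by simp
  qed
  also have "\<dots> \<le> K1 G"
  proof (rule cross_number_le_K1[OF comm_group_axioms comm_group_axioms _ u subgroup_self, of id])
    show "finite (carrier G)" by (simp add: carrier_G)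
    show "g \<in> I \<rightarrow> carrier G" using mod_G by (simp add: g_def)
  qed auto
  finally show ?thesis unfolding G_def .
qed

section \<open>The chain of subgroups\<close>

lemma DirProd_pow:
  "x [^]\<^bsub>G \<times>\<times> H\<^esub> (n :: nat) = (fst x [^]\<^bsub>G\<^esub> n, snd x [^]\<^bsub>H\<^esub> n)"
  by (induction n) (simp_all add: mult_DirProd')

lemma cyclic_power_carrier:
  assumes "r > 0"
  shows "b \<in> carrier (cyclic_power r n) \<longleftrightarrow> b \<in> ({1..n} \<rightarrow>\<^sub>E {0..<int r})"
  using assms by (simp add: cyclic_power_def carrier_integer_mod_group)

lemma cyclic_power_group: "group (cyclic_power r n)"
  by (simp add: cyclic_power_def)

lemma cyclic_power_mult:
  "a \<otimes>\<^bsub>cyclic_power r n\<^esub> b = (\<lambda>i\<in>{1..n}. (a i + b i) mod int r)"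
  by (simp add: cyclic_power_def)

lemma cyclic_power_one: "\<one>\<^bsub>cyclic_power r n\<^esub> = (\<lambda>i\<in>{1..n}. 0)"
  by (simp add: cyclic_power_def)

lemma cyclic_power_comm_group: "comm_group (cyclic_power r n)"
proof (rule group.group_comm_groupI[OF cyclic_power_group])
  show "x \<otimes>\<^bsub>cyclic_power r n\<^esub> y = y \<otimes>\<^bsub>cyclic_power r n\<^esub> x" for x y
    by (simp add: cyclic_power_mult add.commute)
qed

lemma cyclic_power_pow:
  "b [^]\<^bsub>cyclic_power r n\<^esub> (k :: nat) = (\<lambda>i\<in>{1..n}. (int k * b i) mod int r)"
proof (induction k)
  case (Suc k)
  have "((int k * b i) mod int r + b i) mod int r = (int (Suc k) * b i) mod int r" for i
    by (simp add: mod_simps algebra_simps)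
  then show ?case using Suc by (simp add: cyclic_power_mult cong: restrict_cong)
qed (simp add: cyclic_power_one)

lemma finite_cyclic_power: "r > 0 \<Longrightarrow> finite (carrier (cyclic_power r n))"
  by (simp add: cyclic_power_def carrier_integer_mod_group finite_PiE)

lemma cyclic_power_dvd_ord:
  assumes r: "Factorial_Ring.prime r" and b: "b \<in> carrier (cyclic_power r n)" "b \<noteq> \<one>\<^bsub>cyclic_power r n\<^esub>"
    and k: "b [^]\<^bsub>cyclic_power r n\<^esub> (k :: nat) = \<one>\<^bsub>cyclic_power r n\<^esub>"
  shows "r dvd k"
proof -
  have r0: "r > 0" using prime_gt_0_nat[OF r] .
  have bP: "b \<in> ({1..n} \<rightarrow>\<^sub>E {0..<int r})" using b(1) cyclic_power_carrier[OF r0] by simp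
  have "\<exists>i\<in>{1..n}. b i \<noteq> 0"
  proof (rule ccontr)
    assume "\<not> ?thesis"
    then have "b i = 0" if "i \<in> {1..n}" for i using that by blast
    moreover have "b \<in> extensional {1..n}" using bP by (simp add: PiE_def)
    ultimately have "b = (\<lambda>i\<in>{1..n}. 0)" by (intro extensionalityI[of b "{1..n}"]) auto
    then show False using b(2) by (simp add: cyclic_power_one)
  qed
  then obtain i where i: "i \<in> {1..n}" "b i \<noteq> 0" by blast
  have "(\<lambda>i\<in>{1..n}. (int k * b i) mod int r) i = (\<lambda>i\<in>{1..n}. 0) i"
    using k by (simp only: cyclic_power_pow cyclic_power_one)
  then have "int r dvd int k * b i" using i(1) by (simp add: dvd_eq_mod_eq_0)
  moreover have "\<not> int r dvd b i"
  proof
    assume "int r dvd b i"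
    moreover have "0 \<le> b i" "b i < int r" using PiE_mem[OF bP i(1)] by auto
    ultimately show False using i(2) by (auto dest: zdvd_imp_le)
  qed
  moreover have "Factorial_Ring.prime (int r)" using r by simp
  ultimately have "int r dvd int k" using prime_dvd_multD by blast
  then show ?thesis by simp
qed

section \<open>The layers of the product group and the orders of their elements\<close>

locale cyclic_times_elementary =
  fixes p r m n :: nat
  assumes p: "Factorial_Ring.prime p" and r: "Factorial_Ring.prime r"
begin

definition G :: "(int \<times> (nat \<Rightarrow> int)) monoid" where
  "G = integer_mod_group (p ^ m) \<times>\<times> cyclic_power r n"

definition layer :: "nat \<Rightarrow> (int \<times> (nat \<Rightarrow> int)) set" where
  "layer k = {x \<in> carrier G. int p ^ (m - k) dvd fst x}"

text \<open>The base-p digit of the first component at position m - k. For 1 \<le> k \<le> m all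
  lower digits vanish on \<open>layer k\<close>, and there this digit vanishes exactly on
  \<open>layer (k - 1)\<close>; so it labels the cosets, with p values.\<close>

definition digit :: "nat \<Rightarrow> int \<times> (nat \<Rightarrow> int) \<Rightarrow> int" where
  "digit k x = (fst x div int p ^ (m - k)) mod int p"

lemma p_gt: "p > 0" "p > 1"
  using prime_gt_0_nat[OF p] prime_gt_1_nat[OF p] by simp_all

lemma r_gt: "r > 0" "r > 1"
  using prime_gt_0_nat[OF r] prime_gt_1_nat[OF r] by simp_all

lemma carrier_G: "carrier G = {0..<int p ^ m} \<times> carrier (cyclic_power r n)"
  using p_gt by (simp add: G_def carrier_integer_mod_group)

lemma mult_G: "x \<otimes>\<^bsub>G\<^esub> y = ((fst x + fst y) mod int p ^ m, snd x \<otimes>\<^bsub>cyclic_power r n\<^esub> snd y)"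
  by (simp add: G_def mult_DirProd')

lemma one_G: "\<one>\<^bsub>G\<^esub> = (0, \<one>\<^bsub>cyclic_power r n\<^esub>)"
  by (simp add: G_def)

lemma pow_G: "x [^]\<^bsub>G\<^esub> (k :: nat) = ((int k * fst x) mod int p ^ m, snd x [^]\<^bsub>cyclic_power r n\<^esub> k)"
  by (simp add: G_def DirProd_pow)

lemma comm_group_G: "comm_group G"
proof (rule group.group_comm_groupI)
  show "group G" unfolding G_def by (intro DirProd_group cyclic_power_group) simp
  show "x \<otimes>\<^bsub>G\<^esub> y = y \<otimes>\<^bsub>G\<^esub> x" for x y
    by (simp add: mult_G cyclic_power_mult add.commute)
qed

sublocale comm_group G
  by (rule comm_group_G)

lemma finite_G: "finite (carrier G)"
  unfolding carrier_G using finite_cyclic_power[OF r_gt(1)] by simp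

lemma inv_G: "x \<in> carrier G \<Longrightarrow> fst (inv\<^bsub>G\<^esub> x) = (- fst x) mod int p ^ m"
  using inv_DirProd[OF group_integer_mod_group cyclic_power_group, of "fst x" "p ^ m" "snd x" r n]
  by (auto simp: G_def)

lemma subgroup_layer: "subgroup (layer k) G"
proof (rule subgroupI)
  have d: "int p ^ (m - k) dvd int p ^ m" by (intro le_imp_power_dvd) simp
  show "layer k \<subseteq> carrier G" by (auto simp: layer_def)
  show "layer k \<noteq> {}"
    using one_closed by (auto simp: layer_def one_G intro!: exI[of _ "\<one>\<^bsub>G\<^esub>"])
  show "inv\<^bsub>G\<^esub> x \<in> layer k" if "x \<in> layer k" for x
    using that d by (auto simp: layer_def inv_G dvd_mod_iff)
  show "x \<otimes>\<^bsub>G\<^esub> y \<in> layer k" if "x \<in> layer k" "y \<in> layer k" for x y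
  proof -
    have "x \<otimes>\<^bsub>G\<^esub> y \<in> carrier G" using that by (auto simp: layer_def)
    then show ?thesis using that d by (auto simp: layer_def mult_G dvd_mod_iff)
  qed
qed

lemma layer_top: "layer m = carrier G"
  by (auto simp: layer_def)

lemma coset_labelling_layer:
  assumes k: "k \<in> {1..m}"
  shows "coset_labelling G (layer (k - 1)) (layer k) (digit k) {0..<int p}"
proof -
  have mk: "m - (k - 1) = Suc (m - k)" using k by auto
  show ?thesis
  proof (intro coset_labelling.intro coset_labelling_axioms.intro comm_group_G subgroup_layer)
    show "layer (k - 1) \<subseteq> layer k"
      unfolding layer_def mk by (auto intro: dvd_trans[OF le_imp_power_dvd, rotated])
    show "digit k \<in> layer k \<rightarrow> {0..<int p}" using p_gt by (auto simp: digit_def)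
    fix x y assume xy: "x \<in> layer k" "y \<in> layer k" "digit k x = digit k y"
    then obtain a b where ab: "fst x = int p ^ (m - k) * a" "fst y = int p ^ (m - k) * b"
      by (auto simp: layer_def elim!: dvdE)
    then have "a mod int p = b mod int p" using xy(3) p_gt by (simp add: digit_def)
    then have "int p dvd a - b" by (simp add: mod_eq_dvd_iff)
    then have "int p ^ (m - k) * int p dvd int p ^ (m - k) * (a - b)" by (rule mult_dvd_mono[OF dvd_refl])
    then have d: "int p ^ Suc (m - k) dvd fst x - fst y" by (simp add: ab algebra_simps)
    have dm: "int p ^ Suc (m - k) dvd int p ^ m" using k by (intro le_imp_power_dvd) auto
    have xyG: "x \<in> carrier G" "y \<in> carrier G" using xy by (auto simp: layer_def)
    then have "fst (x \<otimes>\<^bsub>G\<^esub> inv\<^bsub>G\<^esub> y) = (fst x - fst y) mod int p ^ m"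
      by (simp add: mult_G inv_G mod_simps)
    then show "x \<otimes>\<^bsub>G\<^esub> inv\<^bsub>G\<^esub> y \<in> layer (k - 1)"
      using xyG d dm unfolding layer_def mk by (simp add: dvd_mod_iff)
  qed simp
qed

text \<open>The first component is p^(m-k) times an integer prime to p, so already its order in the
  cyclic factor is p^k.\<close>

lemma ord_G_dvd:
  assumes k: "k \<in> {1..m}" and x: "x \<in> layer k - layer (k - 1)"
  shows "p ^ k dvd ord x"
proof -
  have xG: "x \<in> carrier G" and d: "int p ^ (m - k) dvd fst x" "\<not> int p ^ Suc (m - k) dvd fst x"
    using x k by (auto simp: layer_def Suc_diff_le)
  then obtain a where a: "fst x = int p ^ (m - k) * a" by (auto elim: dvdE)
  have "\<not> int p dvd a" using d(2) p_gt by (auto simp: a mult.commute)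
  moreover have "Factorial_Ring.prime (int p)" using p by simp
  ultimately have cop: "coprime (int p ^ k) a" by (simp add: prime_imp_coprime)
  have "x [^]\<^bsub>G\<^esub> ord x = \<one>\<^bsub>G\<^esub>" using xG by simp
  then have "(int (ord x) * fst x) mod int p ^ m = 0" by (simp add: pow_G one_G)
  then have "int p ^ m dvd int (ord x) * fst x" by (simp add: dvd_eq_mod_eq_0)
  moreover have "int p ^ m = int p ^ (m - k) * int p ^ k" using k by (simp flip: power_add)
  moreover have "int (ord x) * fst x = int p ^ (m - k) * (int (ord x) * a)" by (simp add: a)
  ultimately have "int p ^ k dvd int (ord x) * a" using p_gt by simp
  then have "int p ^ k dvd int (ord x)" using cop coprime_dvd_mult_left_iff by blast
  then show ?thesis by (metis of_nat_dvd_iff of_nat_power)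
qed

lemma pow_layer:
  assumes x: "x \<in> layer k" "k \<le> m" and s: "snd x [^]\<^bsub>cyclic_power r n\<^esub> s = \<one>\<^bsub>cyclic_power r n\<^esub>"
    and d: "p ^ k dvd s" and s0: "s > 0"
  shows "ord x \<le> s"
proof -
  have xG: "x \<in> carrier G" using x by (auto simp: layer_def)
  have "int p ^ k dvd int s" using d by (metis of_nat_dvd_iff of_nat_power)
  moreover have "int p ^ (m - k) dvd fst x" using x by (auto simp: layer_def)
  ultimately have "int p ^ k * int p ^ (m - k) dvd int s * fst x" by (rule mult_dvd_mono)
  then have "int p ^ m dvd int s * fst x" using x(2) by (simp flip: power_add)
  then have "x [^]\<^bsub>G\<^esub> s = \<one>\<^bsub>G\<^esub>" by (simp add: pow_G one_G s dvd_eq_mod_eq_0)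
  then have "ord x dvd s" using pow_eq_id[OF xG] by simp
  then show ?thesis using s0 by (rule dvd_imp_le)
qed

lemma pow_elementary_one:
  assumes "r dvd s"
  shows "b [^]\<^bsub>cyclic_power r n\<^esub> s = \<one>\<^bsub>cyclic_power r n\<^esub>"
proof -
  have "int r dvd int s * z" for z using assms by (simp add: dvd_mult2)
  then show ?thesis by (auto simp: cyclic_power_pow cyclic_power_one dvd_eq_mod_eq_0)
qed

lemma ord_ge:
  assumes "x \<in> carrier G" "d dvd ord x"
  shows "d \<le> ord x"
  using assms(2) ord_ge_1[OF finite_G assms(1)] by (intro dvd_imp_le) auto

text \<open>The first component has order p^k outside \<open>layer (k - 1)\<close> and at most
  p^(k-1) inside, and the ratio p is the number of labels; hence s = p^(k-1). A nontrivial second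
  component multiplies the order by r, which is coprime to p; hence t = r.\<close>

lemma descent_distinct:
  assumes k: "k \<in> {1..m}" and pr: "p \<noteq> r"
  shows "descent_step G (layer (k - 1)) (layer k) (digit k) {0..<int p}
    {x \<in> carrier G. snd x = \<one>\<^bsub>cyclic_power r n\<^esub>} (real p ^ (k - 1)) (real r)"
proof -
  interpret E: comm_group "cyclic_power r n" by (rule cyclic_power_comm_group)
  have pk: "real (card {0..<int p}) * real p ^ (k - 1) = real (p ^ k)"
    using k by (cases k) auto
  have pkr: "real (card {0..<int p}) * (real p ^ (k - 1) * real r) = real (p ^ k * r)"
    using k by (cases k) auto
  show ?thesis
  proof (intro descent_step.intro descent_step_axioms.intro coset_labelling_layer[OF k] finite_G)
    show "subgroup {x \<in> carrier G. snd x = \<one>\<^bsub>cyclic_power r n\<^esub>} G"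
    proof (rule subgroupI)
      show "{x \<in> carrier G. snd x = \<one>\<^bsub>cyclic_power r n\<^esub>} \<noteq> {}"
        using one_closed by (auto simp: one_G intro!: exI[of _ "\<one>\<^bsub>G\<^esub>"])
      show "inv\<^bsub>G\<^esub> x \<in> {x \<in> carrier G. snd x = \<one>\<^bsub>cyclic_power r n\<^esub>}"
        if x: "x \<in> {x \<in> carrier G. snd x = \<one>\<^bsub>cyclic_power r n\<^esub>}" for x
      proof -
        have "snd (inv\<^bsub>G\<^esub> x) = inv\<^bsub>cyclic_power r n\<^esub> (snd x)"
          using x inv_DirProd[OF group_integer_mod_group cyclic_power_group, of "fst x" "p ^ m" "snd x" r n]
          by (auto simp: G_def)
        then show ?thesis using x by simp
      qed
      show "x \<otimes>\<^bsub>G\<^esub> y \<in> {x \<in> carrier G. snd x = \<one>\<^bsub>cyclic_power r n\<^esub>}"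
        if "x \<in> {x \<in> carrier G. snd x = \<one>\<^bsub>cyclic_power r n\<^esub>}"
          "y \<in> {x \<in> carrier G. snd x = \<one>\<^bsub>cyclic_power r n\<^esub>}" for x y
        using that m_closed[of x y] by (simp add: mult_G)
    qed auto
    show "0 < real p ^ (k - 1)" "1 \<le> real r" using p_gt r_gt by auto
    fix x
    show "real (card {0..<int p}) * real p ^ (k - 1) \<le> real (ord x)" if x: "x \<in> layer k - layer (k - 1)"
    proof -
      have "x \<in> carrier G" using x by (auto simp: layer_def)
      then show ?thesis unfolding pk using ord_ge ord_G_dvd[OF k x] by simp
    qed
    show "real (card {0..<int p}) * (real p ^ (k - 1) * real r) \<le> real (ord x)"
      if x: "x \<in> layer k - layer (k - 1)" "x \<notin> {x \<in> carrier G. snd x = \<one>\<^bsub>cyclic_power r n\<^esub>}"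
    proof -
      have xG: "x \<in> carrier G" using x by (auto simp: layer_def)
      then have sx: "snd x \<in> carrier (cyclic_power r n)" "snd x \<noteq> \<one>\<^bsub>cyclic_power r n\<^esub>"
        using x(2) by (auto simp: carrier_G)
      have "x [^]\<^bsub>G\<^esub> ord x = \<one>\<^bsub>G\<^esub>" using xG by simp
      then have "snd x [^]\<^bsub>cyclic_power r n\<^esub> ord x = \<one>\<^bsub>cyclic_power r n\<^esub>" by (simp add: pow_G one_G)
      then have "r dvd ord x" by (rule cyclic_power_dvd_ord[OF r sx])
      moreover have "coprime (p ^ k) r" using p r pr by (simp add: primes_coprime)
      ultimately have "p ^ k * r dvd ord x" using ord_G_dvd[OF k x(1)] by (simp add: divides_mult)
      then show ?thesis unfolding pkr using ord_ge[OF xG] by (simp only: of_nat_le_iff)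
    qed
    have k': "k - 1 \<le> m" using k by auto
    show "real (ord x) \<le> real p ^ (k - 1)"
      if "x \<in> layer (k - 1)" "x \<in> {x \<in> carrier G. snd x = \<one>\<^bsub>cyclic_power r n\<^esub>}"
    proof -
      have "ord x \<le> p ^ (k - 1)" using that p_gt by (intro pow_layer[OF _ k']) auto
      then show ?thesis by (metis of_nat_le_iff of_nat_power)
    qed
    show "real (ord x) \<le> real p ^ (k - 1) * real r" if "x \<in> layer (k - 1)"
    proof -
      have "ord x \<le> p ^ (k - 1) * r"
        using that p_gt r_gt by (intro pow_layer[OF _ k'] pow_elementary_one) auto
      then show ?thesis by (metis of_nat_le_iff of_nat_power of_nat_mult)
    qed
  qed
qed

text \<open>The range starts at k = 2: elements of \<open>layer (k - 1)\<close> are to be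
  annihilated by p^(k-1), and this kills the second component as well because it is a multiple of p
  once k \<ge> 2. Nothing lies outside \<open>A\<close>, so t = 1 serves.\<close>

lemma descent_same:
  assumes k: "k \<in> {2..m}" and pr: "p = r"
  shows "descent_step G (layer (k - 1)) (layer k) (digit k) {0..<int p}
    (carrier G) (real p ^ (k - 1)) 1"
proof -
  have k1: "k \<in> {1..m}" and k': "k - 1 \<le> m" using k by auto
  have pk: "real (card {0..<int p}) * real p ^ (k - 1) = real (p ^ k)"
    using k by (cases k) auto
  have le: "real (ord x) \<le> real p ^ (k - 1)" if "x \<in> layer (k - 1)" for x
  proof -
    have "p dvd p ^ (k - 1)" using k by (intro dvd_power) auto
    then have "r dvd p ^ (k - 1)" by (simp add: pr)
    then have "ord x \<le> p ^ (k - 1)"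
      using that p_gt by (intro pow_layer[OF _ k'] pow_elementary_one) auto
    then show ?thesis by (metis of_nat_le_iff of_nat_power)
  qed
  show ?thesis
  proof (intro descent_step.intro descent_step_axioms.intro coset_labelling_layer[OF k1] finite_G subgroup_self)
    show "0 < real p ^ (k - 1)" using p_gt by auto
    show "real (card {0..<int p}) * real p ^ (k - 1) \<le> real (ord x)" if x: "x \<in> layer k - layer (k - 1)" for x
    proof -
      have "x \<in> carrier G" using x by (auto simp: layer_def)
      then show ?thesis unfolding pk using ord_ge ord_G_dvd[OF k1 x] by simp
    qed
  qed (use le in \<open>auto simp: layer_def\<close>)
qed

text \<open>The step from \<open>layer (k + 1)\<close> to \<open>layer k\<close> costs 1/p^k, whence
  the range of the sum. Existentially bound \<open>A\<close> and \<open>t\<close> let both cases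
  share the iteration; the final level \<open>l\<close> is 0 for distinct primes and 1 for equal
  ones.\<close>

lemma iterated_descent:
  fixes g :: "'i \<Rightarrow> int \<times> (nat \<Rightarrow> int)"
  assumes step: "\<And>k. k \<in> {l<..m} \<Longrightarrow>
      \<exists>A t. descent_step G (layer (k - 1)) (layer k) (digit k) {0..<int p} A (real p ^ (k - 1)) t"
    and lm: "l \<le> m" and u: "ufim G g I"
  obtains g' :: "'i \<Rightarrow> int \<times> (nat \<Rightarrow> int)" and I' where "ufim G g' I'" "g' \<in> I' \<rightarrow> layer l"
    "cross_number G g I \<le> cross_number G g' I' + (\<Sum>k=l..<m. 1 / real p ^ k)"
proof -
  have "\<exists>(g' :: 'i \<Rightarrow> int \<times> (nat \<Rightarrow> int)) I'. ufim G g' I' \<and> g' \<in> I' \<rightarrow> layer l \<and>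
      cross_number G g I \<le> cross_number G g' I' + (\<Sum>j=l..<k. 1 / real p ^ j)"
    if "ufim G g I" "g \<in> I \<rightarrow> layer k" "l \<le> k" "k \<le> m" for g :: "'i \<Rightarrow> int \<times> (nat \<Rightarrow> int)" and I k
    using that(3,1,2,4)
  proof (induction k arbitrary: g I rule: dec_induct)
    case base
    then show ?case by (intro exI[of _ g] exI[of _ I]) simp
  next
    case (step k)
    have "Suc k \<in> {l<..m}" using step.hyps step.prems by auto
    then obtain A t where "descent_step G (layer k) (layer (Suc k)) (digit (Suc k)) {0..<int p} A (real p ^ k) t"
      using assms(1) by fastforce
    then interpret D: descent_step G "layer k" "layer (Suc k)" "digit (Suc k)" "{0..<int p}" A "real p ^ k" t .
    obtain g1 :: "'i \<Rightarrow> int \<times> (nat \<Rightarrow> int)" and I1 where 1: "ufim G g1 I1" "g1 \<in> I1 \<rightarrow> layer k"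
      "cross_number G g I \<le> cross_number G g1 I1 + 1 / real p ^ k"
      by (rule D.ufim_descent[OF step.prems(1,2)])
    have "k \<le> m" using step.prems by simp
    from step.IH[OF 1(1,2) this] obtain g' :: "'i \<Rightarrow> int \<times> (nat \<Rightarrow> int)" and I' where
      2: "ufim G g' I'" "g' \<in> I' \<rightarrow> layer l"
        "cross_number G g1 I1 \<le> cross_number G g' I' + (\<Sum>j=l..<k. 1 / real p ^ j)"
      by (elim exE conjE)
    have "(\<Sum>j=l..<Suc k. 1 / real p ^ j) = (\<Sum>j=l..<k. 1 / real p ^ j) + 1 / real p ^ k"
      using step.hyps by simp
    then show ?case using 1(3) 2 by (intro exI[of _ g'] exI[of _ I'] conjI) linarith+
  qed
  moreover have "g \<in> I \<rightarrow> layer m" using u by (auto simp: layer_top ufim_def)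
  ultimately show ?thesis using u lm that by blast
qed

section \<open>The two estimates at the end of the chain\<close>

lemma K1_distinct:
  assumes "p \<noteq> r"
  shows "K1 G \<le> K1 (integer_mod_group (p ^ m)) + K1 (cyclic_power r n)"
proof (rule K1_leI[OF comm_group_G finite_G])
  fix g :: "nat \<Rightarrow> int \<times> (nat \<Rightarrow> int)" and l assume u: "ufim G g {1..l}"
  have "\<exists>A t. descent_step G (layer (k - 1)) (layer k) (digit k) {0..<int p} A (real p ^ (k - 1)) t"
    if "k \<in> {0<..m}" for k
    using descent_distinct[of k] that assms by (intro exI) auto
  then obtain g' :: "nat \<Rightarrow> int \<times> (nat \<Rightarrow> int)" and I' where
    g': "ufim G g' I'" "g' \<in> I' \<rightarrow> layer 0"
      "cross_number G g {1..l} \<le> cross_number G g' I' + (\<Sum>k=0..<m. 1 / real p ^ k)"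
    using iterated_descent[OF _ le0 u] by blast
  \<comment> \<open>At level 0 the first component is a multiple of p^m below p^m, hence 0; the
    second projection then embeds the layer.\<close>
  have layer0: "fst x = 0" "snd x \<in> carrier (cyclic_power r n)" if "x \<in> layer 0" for x
    using that p_gt by (auto simp: layer_def carrier_G dest: zdvd_imp_le)
  have "cross_number G g' I' \<le> K1 (cyclic_power r n)"
  proof (rule cross_number_le_K1[OF comm_group_G cyclic_power_comm_group _ g'(1) subgroup_layer g'(2)])
    show "inj_on snd (layer 0)" using layer0(1) by (auto simp: inj_on_def prod_eq_iff)
  qed (use layer0 in \<open>simp_all add: mult_G finite_cyclic_power r_gt\<close>)
  moreover have "(\<Sum>k=0..<m. 1 / real p ^ k) \<le> K1 (integer_mod_group (p ^ m))"
    using K1_integer_mod_group_ge[OF p, of m] by (simp add: lessThan_atLeast0)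
  ultimately show "cross_number G g {1..l} \<le> K1 (integer_mod_group (p ^ m)) + K1 (cyclic_power r n)"
    using g'(3) by linarith
qed

lemma K1_same:
  assumes pr: "p = r" and m: "m > 0"
  shows "K1 G \<le> K1 (integer_mod_group (p ^ m)) + K1 (cyclic_power p (n + 1)) - 1"
proof (rule K1_leI[OF comm_group_G finite_G])
  fix g :: "nat \<Rightarrow> int \<times> (nat \<Rightarrow> int)" and l assume u: "ufim G g {1..l}"
  have step: "\<exists>A t. descent_step G (layer (k - 1)) (layer k) (digit k) {0..<int p} A (real p ^ (k - 1)) t"
    if "k \<in> {1<..m}" for k
    using descent_same[of k] that pr by (intro exI) auto
  have m1: "1 \<le> m" using m by simp
  obtain g' :: "nat \<Rightarrow> int \<times> (nat \<Rightarrow> int)" and I' where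
    g': "ufim G g' I'" "g' \<in> I' \<rightarrow> layer 1"
      "cross_number G g {1..l} \<le> cross_number G g' I' + (\<Sum>k=1..<m. 1 / real p ^ k)"
    by (rule iterated_descent[OF step m1 u])
  have pm: "int p ^ m = int p ^ (m - 1) * int p" using m by (cases m) auto
  have layer1: "fst x = int p ^ (m - 1) * (fst x div int p ^ (m - 1))"
    "fst x div int p ^ (m - 1) \<in> {0..<int p}" "snd x \<in> {1..n} \<rightarrow>\<^sub>E {0..<int p}" if x: "x \<in> layer 1" for x
  proof -
    have d: "int p ^ (m - 1) dvd fst x" and f: "0 \<le> fst x" "fst x < int p ^ m"
      and "snd x \<in> carrier (cyclic_power r n)"
      using x by (auto simp: layer_def carrier_G)
    then show "snd x \<in> {1..n} \<rightarrow>\<^sub>E {0..<int p}" using cyclic_power_carrier r_gt(1) pr by simp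
    show e: "fst x = int p ^ (m - 1) * (fst x div int p ^ (m - 1))" using d by simp
    have P: "0 < int p ^ (m - 1)" using p_gt by simp
    have "int p ^ (m - 1) * (fst x div int p ^ (m - 1)) < int p ^ (m - 1) * int p"
      using f(2) e pm by simp
    then show "fst x div int p ^ (m - 1) \<in> {0..<int p}"
      using P f(1) by (simp add: pos_imp_zdiv_nonneg_iff)
  qed
  \<comment> \<open>On \<open>layer 1\<close> the first component is a p^(m-1) with 0 \<le> a < p;
    this a becomes the extra coordinate, at index n + 1.\<close>
  define \<phi> where
    "\<phi> = (\<lambda>x. \<lambda>i\<in>{1..n + 1}. if i = n + 1 then fst x div int p ^ (m - 1) else snd x i :: int)"
  have "cross_number G g' I' \<le> K1 (cyclic_power p (n + 1))"
  proof (rule cross_number_le_K1[OF comm_group_G cyclic_power_comm_group _ g'(1) subgroup_layer g'(2), of _ _ \<phi>])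
    show "finite (carrier (cyclic_power p (n + 1)))" using p_gt by (simp add: finite_cyclic_power)
    show "\<phi> x \<in> carrier (cyclic_power p (n + 1))" if "x \<in> layer 1" for x
      unfolding cyclic_power_carrier[OF p_gt(1)] \<phi>_def
      using layer1(2,3)[OF that] by (auto simp: PiE_iff)
    show "inj_on \<phi> (layer 1)"
    proof (rule inj_onI)
      fix x y assume xy: "x \<in> layer 1" "y \<in> layer 1" "\<phi> x = \<phi> y"
      have eq: "\<phi> x i = \<phi> y i" for i using xy(3) by simp
      have "fst x div int p ^ (m - 1) = fst y div int p ^ (m - 1)" using eq[of "n + 1"] by (simp add: \<phi>_def)
      then have "fst x = fst y" using layer1(1)[OF xy(1)] layer1(1)[OF xy(2)] by simp
      moreover have "snd x i = snd y i" if "i \<in> {1..n}" for i using eq[of i] that by (simp add: \<phi>_def)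
      then have "snd x = snd y" using layer1(3)[OF xy(1)] layer1(3)[OF xy(2)] by (rule PiE_ext[rotated 2])
      ultimately show "x = y" by (rule prod_eqI)
    qed
    show "\<phi> (x \<otimes>\<^bsub>G\<^esub> y) = \<phi> x \<otimes>\<^bsub>cyclic_power p (n + 1)\<^esub> \<phi> y" if xy: "x \<in> layer 1" "y \<in> layer 1" for x y
    proof -
      define a b where ab: "a = fst x div int p ^ (m - 1)" "b = fst y div int p ^ (m - 1)"
      have "(fst x + fst y) mod int p ^ m = int p ^ (m - 1) * ((a + b) mod int p)"
        using layer1(1)[OF xy(1)] layer1(1)[OF xy(2)] unfolding ab[symmetric] pm
        by (simp add: mult_mod_right distrib_left)
      then have "(fst x + fst y) mod int p ^ m div int p ^ (m - 1) = (a + b) mod int p"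
        using p_gt by simp
      moreover have "x \<otimes>\<^bsub>G\<^esub> y
          = ((fst x + fst y) mod int p ^ m, \<lambda>i\<in>{1..n}. (snd x i + snd y i) mod int p)"
        unfolding mult_G cyclic_power_mult using pr by simp
      ultimately show ?thesis
        by (auto simp: \<phi>_def cyclic_power_mult ab fun_eq_iff restrict_def)
    qed
  qed
  \<comment> \<open>The losses begin with 1/p, so the summand 1 of the lower bound, belonging to k =
    0, is left over.\<close>
  moreover have "1 + (\<Sum>k=1..<m. 1 / real p ^ k) \<le> K1 (integer_mod_group (p ^ m))"
    using K1_integer_mod_group_ge[OF p, of m] m
    by (simp add: lessThan_atLeast0 sum.atLeast_Suc_lessThan)
  ultimately show "cross_number G g {1..l}
      \<le> K1 (integer_mod_group (p ^ m)) + K1 (cyclic_power p (n + 1)) - 1"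
    using g'(3) by linarith
qed

end

theorem theorem6:
  fixes p q m n :: nat
  assumes "Factorial_Ring.prime p" and "Factorial_Ring.prime q" and "p \<noteq> q" and "m > 0" and "n > 0"
  shows "K1 (integer_mod_group (p ^ m) \<times>\<times> cyclic_power p n)
           \<le> K1 (integer_mod_group (p ^ m)) + K1 (cyclic_power p (n + 1)) - 1
       \<and> K1 (integer_mod_group (p ^ m) \<times>\<times> cyclic_power q n)
           \<le> K1 (integer_mod_group (p ^ m)) + K1 (cyclic_power q n)"
proof -
  interpret same: cyclic_times_elementary p p m n using assms by unfold_locales
  interpret distinct: cyclic_times_elementary p q m n using assms by unfold_locales
  show ?thesis
    using same.K1_same[OF refl assms(4)] distinct.K1_distinct[OF assms(3)]
    unfolding same.G_def distinct.G_def ..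
qed

end
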